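(* Let $n\ge2$, $k>2$ and let $V\in\mathbb{C}[q_1,\ldots,q_n]$ be a homogeneous polynomial of degree $k$ all of whose Darboux points are proper and simple. Then $$\sum_{[d]\in\mathscr{D}^\star(V)}\frac{\tau_1(\boldsymbol\Lambda(d))^r}{\tau_{n-1}(\boldsymbol\Lambda(d))}=(-1)^{n-1}\bigl(-n-(k-2)\bigr)^r$$ and $$\sum_{[d]\in\mathscr{D}^\star(V)}\frac{\tau_r(\boldsymbol\Lambda(d))}{\tau_{n-1}(\boldsymbol\Lambda(d))}=(-1)^{r+n-1}\sum_{i=0}^{r}\binom{n-i-1}{r-i}(k-1)^{i}$$ for $r=0,\ldots,n-1$.
   Context: A Darboux point of $V$ is a point $[d]\in\mathbb{CP}^{n-1}$ with $V'(d)=\gamma d$ for some $\gamma\in\mathbb{C}$ ($V'$ is the gradient, $d\ne0$); it is proper if $V'(d)\ne0$. The set $\mathscr{D}(V)$ of Darboux points is the projective algebraic set of common zeros of $R_{i,j}=q_i\partial V/\partial q_j-q_j\partial V/\partial q_i$, $1\le i<j\le n$; $\mathscr{D}^\star(V)$ is the set of proper Darboux points. If no Darboux point is improper, $\mathscr{D}(V)$ is finite. A point of a finite projective algebraic set in $\mathbb{CP}^m$ given by homogeneous polynomials is simple if, in an affine chart containing it, the Jacobian matrix of the dehomogenised polynomials has rank $m$ there; the polynomials used for $\mathscr{D}(V)\subset\mathbb{CP}^{n-1}$ are the $R_{i,j}$. For a proper Darboux point the representative $d$ is chosen so that $V'(d)=d$. Then the Hessian $V''(d)$ has the eigenvalue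 $\lambda_n=k-1$ (with eigenvector $d$); let $\lambda_1(d),\ldots,\lambda_{n-1}(d)$ be the remaining eigenvalues (with algebraic multiplicity), $\Lambda_i(d)=\lambda_i(d)-1$, and $\boldsymbol\Lambda(d)=(\Lambda_1(d),\ldots,\Lambda_{n-1}(d))$; up to order these do not depend on the choice of $d$ with $V'(d)=d$. $\tau_r$, $0\le r\le n-1$, is the elementary symmetric polynomial of degree $r$ in $n-1$ variables, $\tau_0=1$. A zeroth power is $1$. *)

theory Defs
  imports
    "HOL-Analysis.Analysis"
    "HOL-Library.Poly_Mapping"
    "HOL-Computational_Algebra.Computational_Algebra"
begin

text \<open>
  Polynomials over the complex numbers in the variables \<open>q\<^sub>i\<close>, with \<open>i\<close> ranging over a finite
  index type \<open>'n\<close>. The key of a coefficient is the exponent vector of its monomial, so the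
  ring operations of \<open>Poly_Mapping\<close> (convolution) are those of the polynomial ring. The number
  \<open>n\<close> of variables is \<open>CARD('n)\<close>.
\<close>

type_synonym 'n cpoly = "('n \<Rightarrow>\<^sub>0 nat) \<Rightarrow>\<^sub>0 complex"

definition eval_poly :: "'n::finite cpoly \<Rightarrow> complex^'n \<Rightarrow> complex" where
  "eval_poly p x = (\<Sum>m\<in>Poly_Mapping.keys p.
     Poly_Mapping.lookup p m * (\<Prod>i\<in>UNIV. x $ i ^ Poly_Mapping.lookup m i))"

definition variable :: "'n::finite \<Rightarrow> 'n cpoly" where
  "variable i = Poly_Mapping.single (Poly_Mapping.single i 1) 1"

text \<open>The formal partial derivative with respect to \<open>q\<^sub>i\<close>. If \<open>q\<^sub>i\<close> does not occur in a monomial,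
  the subtraction of exponents truncates, but then the coefficient is zero.\<close>

definition partial :: "'n::finite \<Rightarrow> 'n cpoly \<Rightarrow> 'n cpoly" where
  "partial i p = (\<Sum>m\<in>Poly_Mapping.keys p.
     Poly_Mapping.single (m - Poly_Mapping.single i 1)
       (of_nat (Poly_Mapping.lookup m i) * Poly_Mapping.lookup p m))"

definition homogeneous :: "nat \<Rightarrow> 'n::finite cpoly \<Rightarrow> bool" where
  "homogeneous k p \<longleftrightarrow>
     (\<forall>m\<in>Poly_Mapping.keys p. (\<Sum>i\<in>UNIV. Poly_Mapping.lookup m i) = k)"

text \<open>Dehomogenisation: substitution of \<open>1\<close> for \<open>q\<^sub>l\<close>.\<close>

definition dehomogenise :: "'n::finite \<Rightarrow> 'n cpoly \<Rightarrow> 'n cpoly" where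
  "dehomogenise l p = (\<Sum>m\<in>Poly_Mapping.keys p.
     Poly_Mapping.single (m - Poly_Mapping.single l (Poly_Mapping.lookup m l))
       (Poly_Mapping.lookup p m))"

definition gradient :: "'n::finite cpoly \<Rightarrow> complex^'n \<Rightarrow> complex^'n" where
  "gradient V x = (\<chi> i. eval_poly (partial i V) x)"

definition hessian :: "'n::finite cpoly \<Rightarrow> complex^'n \<Rightarrow> complex^'n^'n" where
  "hessian V x = (\<chi> i j. eval_poly (partial j (partial i V)) x)"

text \<open>Points of the complex projective space of dimension \<open>CARD('n) - 1\<close> are represented as
  punctured lines through the origin.\<close>

definition proj_point :: "complex^'n::finite \<Rightarrow> (complex^'n) set" where
  "proj_point d = {c *s d | c. c \<noteq> 0}"

definition is_darboux :: "'n::finite cpoly \<Rightarrow> complex^'n \<Rightarrow> bool" where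
  "is_darboux V d \<longleftrightarrow> d \<noteq> 0 \<and> (\<exists>\<gamma>. gradient V d = \<gamma> *s d)"

definition is_proper_darboux :: "'n::finite cpoly \<Rightarrow> complex^'n \<Rightarrow> bool" where
  "is_proper_darboux V d \<longleftrightarrow> is_darboux V d \<and> gradient V d \<noteq> 0"

definition proper_darboux_points :: "'n::finite cpoly \<Rightarrow> (complex^'n) set set" where
  "proper_darboux_points V = proj_point ` {d. is_proper_darboux V d}"

text \<open>
  A point \<open>[d]\<close> of the projective set cut out by the homogeneous polynomials \<open>F a\<close> is simple if
  in some chart \<open>d\<^sub>l \<noteq> 0\<close> the Jacobian matrix of the dehomogenised polynomials has full rank
  \<open>CARD('n) - 1\<close> at the point. The matrix below also has a column for the variable \<open>q\<^sub>l\<close>; the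
  dehomogenised polynomials do not contain \<open>q\<^sub>l\<close>, so that column vanishes and the rank is that
  of the Jacobian matrix in the \<open>CARD('n) - 1\<close> affine coordinates.
\<close>

definition simple_point :: "('a::finite \<Rightarrow> 'n::finite cpoly) \<Rightarrow> complex^'n \<Rightarrow> bool" where
  "simple_point F d \<longleftrightarrow> (\<exists>l. d $ l \<noteq> 0 \<and>
     rank (\<chi> a j. eval_poly (partial j (dehomogenise l (F a))) (inverse (d $ l) *s d))
       = CARD('n) - 1)"

text \<open>
  The polynomials \<open>R\<^sub>i\<^sub>j\<close> defining the set of Darboux points, indexed by all pairs \<open>(i, j)\<close>, as
  \<open>'n\<close> carries no order. Since \<open>R\<^sub>j\<^sub>i = - R\<^sub>i\<^sub>j\<close> and \<open>R\<^sub>i\<^sub>i = 0\<close>, this changes neither the zero set nor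
  the rank of the Jacobian matrix compared with indexing by \<open>i < j\<close>.
\<close>

definition darboux_eqs :: "'n::finite cpoly \<Rightarrow> 'n \<times> 'n \<Rightarrow> 'n cpoly" where
  "darboux_eqs V = (\<lambda>(i, j). variable i * partial j V - variable j * partial i V)"

text \<open>The normalised representative of a proper Darboux point. It is unique up to a
  \<open>(k-2)\<close>-th root of unity, which does not affect the eigenvalues of the Hessian.\<close>

definition darboux_rep :: "'n::finite cpoly \<Rightarrow> (complex^'n) set \<Rightarrow> complex^'n" where
  "darboux_rep V P = (SOME d. d \<in> P \<and> gradient V d = d)"

definition charpoly :: "complex^'n^'n::finite \<Rightarrow> complex poly" where
  "charpoly A = det (mat [:0, 1:] - map_matrix (\<lambda>c. [:c:]) A)"

text \<open>The eigenvalues with algebraic multiplicity.\<close>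

definition eigenvalues :: "complex^'n^'n::finite \<Rightarrow> complex multiset" where
  "eigenvalues A = proots (charpoly A)"

text \<open>The tuple of the \<open>\<Lambda>\<^sub>i(d) = \<lambda>\<^sub>i(d) - 1\<close>, where the \<open>\<lambda>\<^sub>i(d)\<close> are the eigenvalues of the Hessian
  that remain after removing \<open>k - 1\<close> once, listed in an arbitrary order.\<close>

definition Lambda :: "nat \<Rightarrow> 'n::finite cpoly \<Rightarrow> complex^'n \<Rightarrow> complex list" where
  "Lambda k V d = map (\<lambda>z. z - 1)
     (SOME zs. mset zs = eigenvalues (hessian V d) - {#of_nat k - 1#})"

text \<open>The elementary symmetric polynomial of degree \<open>r\<close>, evaluated at a tuple.\<close>

definition tau :: "nat \<Rightarrow> complex list \<Rightarrow> complex" where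
  "tau r xs = (\<Sum>I | I \<subseteq> {..<length xs} \<and> card I = r. \<Prod>i\<in>I. xs ! i)"

end

theory Submission
  imports Defs
begin

text \<open>
  The solutions of \<open>V'(q) = q\<close> are \<open>0\<close> and, for each Darboux point, the \<open>k - 2\<close> normalised
  representatives \<open>d\<close>, at which the Jacobian determinant of \<open>V'(q) - q\<close> is
  \<open>(k - 2) \<tau>\<^sub>n\<^sub>-\<^sub>1(\<Lambda>(d))\<close>. Since \<open>V'\<close> has no zeros at infinity, the Euler--Jacobi theorem says that
  the sum over all solutions of \<open>g / det (V'' - 1)\<close> vanishes for polynomials \<open>g\<close> of degree less than
  \<open>n (k - 2)\<close>. Taking for \<open>g\<close> a power of \<open>tr V'' - n - (k - 2)\<close> gives the first identity, and
  \<open>det (1 + t (V'' - 1)) - t ^ n det (V'' - 1)\<close>, whose terms of degree \<open>n (k - 2)\<close> cancel,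
  gives the generating function in \<open>t\<close> of the sums in the second one.

  The Euler--Jacobi theorem for \<open>F\<^sub>1, \<dots>, F\<^sub>n\<close> is obtained algebraically. By the Nullstellensatz, the
  powers \<open>q\<^sub>j ^ M\<close> are combinations of the leading forms, so \<open>A F = G\<close> with \<open>G\<^sub>j = q\<^sub>j ^ M + l\<^sub>j\<close>, where
  \<open>l\<^sub>j\<close> has degree less than \<open>M\<close>. Write \<open>F(q) = D\<^sub>a(q) (q - a)\<close> at a zero \<open>a\<close>. By Cramer's rule and the
  Nullstellensatz, \<open>g\<close> is congruent to the sum of the \<open>g(a) / J(a) \<cdot> det D\<^sub>a\<close> modulo the \<open>F\<^sub>i\<close>.
  Multiplying by \<open>det A\<close> gives a congruence modulo the \<open>G\<^sub>j\<close>, in which the coefficients of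
  \<open>\<Prod>\<^sub>j q\<^sub>j ^ (M - 1)\<close> can be compared.
\<close>

section \<open>Polynomials in several variables\<close>

abbreviation Const :: "complex \<Rightarrow> 'n::finite cpoly" where
  "Const c \<equiv> Poly_Mapping.single 0 c"

abbreviation coeffp :: "'n::finite cpoly \<Rightarrow> ('n \<Rightarrow>\<^sub>0 nat) \<Rightarrow> complex" where
  "coeffp \<equiv> Poly_Mapping.lookup"

lemma poly_mapping_sum_singles:
  fixes p :: "'a \<Rightarrow>\<^sub>0 'b::comm_monoid_add"
  shows "(\<Sum>m\<in>Poly_Mapping.keys p. Poly_Mapping.single m (Poly_Mapping.lookup p m)) = p"
proof (rule poly_mapping_eqI)
  fix m
  show "Poly_Mapping.lookup (\<Sum>m\<in>Poly_Mapping.keys p. Poly_Mapping.single m (Poly_Mapping.lookup p m)) m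
      = Poly_Mapping.lookup p m"
    by (cases "m \<in> Poly_Mapping.keys p")
      (auto simp: lookup_sum lookup_single when_def in_keys_iff)
qed

text \<open>A finitely supported function is a finite sum of singles, so a claim that is additive in
  \<open>p\<close> need only be checked on monomials with a coefficient.\<close>

lemma poly_mapping_induct_singles [case_names single add]:
  fixes p :: "'a \<Rightarrow>\<^sub>0 'b::comm_monoid_add"
  assumes single: "\<And>m c. P (Poly_Mapping.single m c)"
    and add: "\<And>p q. P p \<Longrightarrow> P q \<Longrightarrow> P (p + q)"
  shows "P p"
proof -
  have "P (\<Sum>m\<in>A. Poly_Mapping.single m (Poly_Mapping.lookup p m))" if "finite A" for A
    using that
  proof (induction A)
    case empty
    show ?case using single[of undefined 0] by simp
  qed (simp add: single add)
  from this[of "Poly_Mapping.keys p"] show ?thesis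
    by (simp add: poly_mapping_sum_singles)
qed

section \<open>Evaluation at a point as a ring homomorphism\<close>

lemma eval_poly_add: "eval_poly (p + q) x = eval_poly p x + eval_poly q x"
  unfolding eval_poly_def
  by (rule setsum_keys_plus_distrib[where f = "\<lambda>m c. c * (\<Prod>i\<in>UNIV. x $ i ^ Poly_Mapping.lookup m i)"])
    (simp_all add: algebra_simps)

lemma eval_poly_single:
  "eval_poly (Poly_Mapping.single m c) x = c * (\<Prod>i\<in>UNIV. x $ i ^ Poly_Mapping.lookup m i)"
  by (cases "c = 0") (simp_all add: eval_poly_def)

lemma eval_poly_0 [simp]: "eval_poly 0 x = 0"
  by (simp add: eval_poly_def)

lemma eval_poly_Const [simp]: "eval_poly (Const c) x = c"
  by (simp add: eval_poly_single)

lemma eval_poly_1 [simp]: "eval_poly 1 x = 1"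
  using eval_poly_Const[of 1 x] by simp

lemma eval_poly_variable [simp]: "eval_poly (variable i) x = x $ i"
proof -
  have "(\<Prod>j\<in>UNIV. x $ j ^ Poly_Mapping.lookup (Poly_Mapping.single i (1::nat)) j)
      = (\<Prod>j\<in>UNIV. if j = i then x $ j else 1)"
    by (rule prod.cong) (auto simp: lookup_single when_def)
  then show ?thesis by (simp add: variable_def eval_poly_single)
qed

lemma eval_poly_mult: "eval_poly (p * q) x = eval_poly p x * eval_poly q x"
proof (induction p rule: poly_mapping_induct_singles)
  case (single m c)
  show ?case
  proof (induction q rule: poly_mapping_induct_singles)
    case (single m' c')
    show ?case
      by (simp add: mult_single eval_poly_single lookup_add power_add prod.distrib)
  qed (simp add: algebra_simps eval_poly_add)
qed (simp add: algebra_simps eval_poly_add)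

lemma eval_poly_uminus: "eval_poly (- p) x = - eval_poly p x"
  using eval_poly_add[of p "- p" x] by (simp add: eq_neg_iff_add_eq_0 add.commute)

lemma eval_poly_diff: "eval_poly (p - q) x = eval_poly p x - eval_poly q x"
  using eval_poly_add[of p "- q" x] by (simp add: eval_poly_uminus)

lemma eval_poly_sum: "eval_poly (sum f A) x = (\<Sum>a\<in>A. eval_poly (f a) x)"
  by (induction A rule: infinite_finite_induct) (simp_all add: eval_poly_add)

lemma eval_poly_prod: "eval_poly (prod f A) x = (\<Prod>a\<in>A. eval_poly (f a) x)"
  by (induction A rule: infinite_finite_induct) (simp_all add: eval_poly_mult)

lemma eval_poly_power: "eval_poly (p ^ r) x = eval_poly p x ^ r"
  by (induction r) (simp_all add: eval_poly_mult)

lemma eval_poly_of_int: "eval_poly (of_int z) x = of_int z"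
  by (metis eval_poly_Const single_of_int)

lemmas eval_poly_simps = eval_poly_add eval_poly_mult eval_poly_uminus eval_poly_diff
  eval_poly_sum eval_poly_prod eval_poly_power eval_poly_of_int

lemma eval_poly_det: "eval_poly (det A) x = det (\<chi> i j. eval_poly (A $ i $ j) x)"
  by (simp add: det_def eval_poly_simps)

subsection \<open>Degrees and homogeneous parts\<close>

definition mdeg :: "('n::finite \<Rightarrow>\<^sub>0 nat) \<Rightarrow> nat" where
  "mdeg m = (\<Sum>i\<in>UNIV. Poly_Mapping.lookup m i)"

text \<open>An upper bound instead of an exact degree: it holds for 0 with every \<open>d\<close>
  and survives cancellation in sums.\<close>

definition deg_le :: "nat \<Rightarrow> 'n::finite cpoly \<Rightarrow> bool" where
  "deg_le d p \<longleftrightarrow> (\<forall>m\<in>Poly_Mapping.keys p. mdeg m \<le> d)"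

definition hpart :: "nat \<Rightarrow> 'n::finite cpoly \<Rightarrow> 'n cpoly" where
  "hpart d p = (\<Sum>m | m \<in> Poly_Mapping.keys p \<and> mdeg m = d. Poly_Mapping.single m (coeffp p m))"

lemma mdeg_add: "mdeg (m + m') = mdeg m + mdeg m'"
  by (simp add: mdeg_def lookup_add sum.distrib)

lemma mdeg_0 [simp]: "mdeg 0 = 0"
  by (simp add: mdeg_def)

lemma mdeg_single [simp]: "mdeg (Poly_Mapping.single i e) = e"
  by (simp add: mdeg_def lookup_single when_def)

lemma finite_mdeg_le: "finite {m :: 'n::finite \<Rightarrow>\<^sub>0 nat. mdeg m \<le> d}"
proof (rule finite_imageD)
  have "Poly_Mapping.lookup m i \<le> mdeg m" for m :: "'n \<Rightarrow>\<^sub>0 nat" and i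
    unfolding mdeg_def by (rule member_le_sum) auto
  then have "Poly_Mapping.lookup ` {m :: 'n \<Rightarrow>\<^sub>0 nat. mdeg m \<le> d} \<subseteq> PiE UNIV (\<lambda>_. {..d})"
    by (auto simp: PiE_UNIV_domain intro: order_trans)
  then show "finite (Poly_Mapping.lookup ` {m :: 'n \<Rightarrow>\<^sub>0 nat. mdeg m \<le> d})"
    by (rule finite_subset) (simp add: finite_PiE)
  show "inj_on Poly_Mapping.lookup {m :: 'n \<Rightarrow>\<^sub>0 nat. mdeg m \<le> d}"
    by (auto intro!: inj_onI poly_mapping_eqI)
qed

lemma deg_leD: "deg_le d p \<Longrightarrow> mdeg m > d \<Longrightarrow> coeffp p m = 0"
  unfolding deg_le_def by (metis in_keys_iff not_le)

lemma deg_leI: "(\<And>m. mdeg m > d \<Longrightarrow> coeffp p m = 0) \<Longrightarrow> deg_le d p"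
  unfolding deg_le_def by (metis in_keys_iff not_le)

lemma deg_le_mono: "deg_le d p \<Longrightarrow> d \<le> e \<Longrightarrow> deg_le e p"
  unfolding deg_le_def by auto

lemma ex_deg_le: "\<exists>d. deg_le d p"
proof
  show "deg_le (\<Sum>m\<in>Poly_Mapping.keys p. mdeg m) p"
    unfolding deg_le_def by (auto intro: member_le_sum)
qed

lemma deg_le_0 [simp]: "deg_le d 0"
  by (simp add: deg_le_def)

lemma deg_le_single: "mdeg m \<le> d \<Longrightarrow> deg_le d (Poly_Mapping.single m c)"
  by (cases "c = 0") (simp_all add: deg_le_def)

lemma deg_le_Const [simp]: "deg_le d (Const c)"
  by (simp add: deg_le_single)

lemma deg_le_1 [simp]: "deg_le d 1"
  using deg_le_Const[of d 1] by simp

lemma deg_le_of_int [simp]: "deg_le d (of_int z)"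
  by (metis deg_le_Const single_of_int)

lemma deg_le_variable: "1 \<le> d \<Longrightarrow> deg_le d (variable i)"
  unfolding variable_def by (rule deg_le_single) simp

lemma deg_le_add: "deg_le d p \<Longrightarrow> deg_le d q \<Longrightarrow> deg_le d (p + q)"
  by (auto intro!: deg_leI simp: lookup_add deg_leD)

lemma deg_le_uminus: "deg_le d p \<Longrightarrow> deg_le d (- p)"
  by (auto intro!: deg_leI simp: deg_leD)

lemma deg_le_diff: "deg_le d p \<Longrightarrow> deg_le d q \<Longrightarrow> deg_le d (p - q)"
  by (auto intro!: deg_leI simp: lookup_minus deg_leD)

lemma deg_le_sum: "(\<And>a. a \<in> A \<Longrightarrow> deg_le d (f a)) \<Longrightarrow> deg_le d (sum f A)"
  by (induction A rule: infinite_finite_induct) (auto intro: deg_le_add)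

lemma deg_le_mult: "deg_le d p \<Longrightarrow> deg_le e q \<Longrightarrow> deg_le (d + e) (p * q)"
  unfolding deg_le_def using keys_mult[of p q] by (fastforce simp: mdeg_add intro: add_mono)

lemma deg_le_prod: "(\<And>a. a \<in> A \<Longrightarrow> deg_le (d a) (f a)) \<Longrightarrow> deg_le (sum d A) (prod f A)"
  by (induction A rule: infinite_finite_induct) (auto intro: deg_le_mult)

lemma deg_le_power: "deg_le d p \<Longrightarrow> deg_le (r * d) (p ^ r)"
  by (induction r) (auto intro: deg_le_mult)

lemma deg_le_det:
  fixes A :: "'n::finite cpoly^'m::finite^'m"
  assumes "\<And>i j. deg_le d (A $ i $ j)"
  shows "deg_le (CARD('m) * d) (det A)"
  unfolding det_def
proof (intro deg_le_sum)
  fix \<sigma> :: "'m \<Rightarrow> 'm"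
  have "deg_le (\<Sum>i\<in>(UNIV::'m set). d) (\<Prod>i\<in>UNIV. A $ i $ \<sigma> i)"
    by (rule deg_le_prod) (rule assms)
  from deg_le_mult[OF deg_le_of_int this, of 0 "sign \<sigma>"]
  show "deg_le (CARD('m) * d) (of_int (sign \<sigma>) * (\<Prod>i\<in>UNIV. A $ i $ \<sigma> i))"
    by simp
qed

lemma lookup_hpart: "coeffp (hpart d p) m = (if mdeg m = d then coeffp p m else 0)"
proof -
  have "coeffp (hpart d p) m
      = (\<Sum>m' | m' \<in> Poly_Mapping.keys p \<and> mdeg m' = d. if m' = m then coeffp p m' else 0)"
    unfolding hpart_def lookup_sum by (rule sum.cong) (auto simp: lookup_single when_def)
  also have "\<dots> = (if mdeg m = d then coeffp p m else 0)"
    by (auto simp: in_keys_iff)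
  finally show ?thesis .
qed

lemma hpart_add: "hpart d (p + q) = hpart d p + hpart d q"
  by (rule poly_mapping_eqI) (simp add: lookup_hpart lookup_add)

lemma hpart_diff: "hpart d (p - q) = hpart d p - hpart d q"
  by (rule poly_mapping_eqI) (simp add: lookup_hpart lookup_minus)

lemma hpart_0 [simp]: "hpart d 0 = 0"
  by (rule poly_mapping_eqI) (simp add: lookup_hpart)

lemma hpart_sum: "hpart d (sum f A) = (\<Sum>a\<in>A. hpart d (f a))"
  by (induction A rule: infinite_finite_induct) (simp_all add: hpart_add)

lemma hpart_hpart: "hpart d (hpart e p) = (if d = e then hpart e p else 0)"
  by (rule poly_mapping_eqI) (simp add: lookup_hpart)

lemma hpart_single: "hpart d (Poly_Mapping.single m c) = (if mdeg m = d then Poly_Mapping.single m c else 0)"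
  by (rule poly_mapping_eqI) (auto simp: lookup_hpart lookup_single when_def)

lemma hpart_1: "hpart d 1 = (if d = 0 then 1 else 0)"
  using hpart_single[of d 0 1] unfolding single_one by simp

lemma deg_le_hpart: "deg_le d (hpart d p)"
  by (rule deg_leI) (simp add: lookup_hpart)

lemma hpart_eq_0: "deg_le d p \<Longrightarrow> d < e \<Longrightarrow> hpart e p = 0"
  by (rule poly_mapping_eqI) (auto simp: lookup_hpart deg_leD)

lemma deg_le_diff_hpart: "deg_le d p \<Longrightarrow> d \<ge> 1 \<Longrightarrow> deg_le (d - 1) (p - hpart d p)"
  by (rule deg_leI) (auto simp: lookup_hpart lookup_minus deg_leD)

text \<open>Multiplication by a form of degree \<open>e\<close> shifts the grading by
  \<open>e\<close>; by additivity this is a statement about two monomials.\<close>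

lemma hpart_mult_homogeneous:
  assumes "hpart e q = q"
  shows "hpart d (p * q) = (if e \<le> d then hpart (d - e) p * q else 0)"
proof (induction p rule: poly_mapping_induct_singles)
  case (single m c)
  \<comment> \<open>Summands of a homogeneous polynomial need not be homogeneous. With
    \<open>hpart e q\<close> in place of \<open>q\<close> the claim holds for all \<open>q\<close>
    and is additive.\<close>
  have "hpart d (Poly_Mapping.single m c * hpart e q)
      = (if e \<le> d then hpart (d - e) (Poly_Mapping.single m c) * hpart e q else 0)"
  proof (induction q rule: poly_mapping_induct_singles)
    case (single m' c')
    then show ?case by (auto simp: hpart_single mult_single mdeg_add)
  qed (auto simp: hpart_add algebra_simps)
  then show ?case by (simp add: assms)
qed (auto simp: hpart_add algebra_simps)

text \<open>Leading parts multiply: what \<open>q\<close> has besides its part of degree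
  \<open>e\<close> only yields degrees below \<open>d + e\<close>.\<close>

lemma hpart_mult:
  assumes p: "deg_le d p" and q: "deg_le e q"
  shows "hpart (d + e) (p * q) = hpart d p * hpart e q"
proof -
  have "hpart (d + e) (p * (q - hpart e q)) = 0"
  \<comment> \<open>For \<open>e = 0\<close> the bound \<open>e - 1\<close> would truncate; here
    \<open>q\<close> is a constant and the remainder is 0.\<close>
  proof (cases "e = 0")
    case True
    then have "q - hpart e q = 0"
      using q by (auto intro!: poly_mapping_eqI simp: lookup_minus lookup_hpart deg_leD)
    then show ?thesis by simp
  next
    case False
    then have "deg_le (d + (e - 1)) (p * (q - hpart e q))"
      by (intro deg_le_mult p deg_le_diff_hpart q) simp
    then show ?thesis by (rule hpart_eq_0) (use False in simp)
  qed
  moreover have "hpart (d + e) (p * hpart e q) = hpart d p * hpart e q"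
    by (subst hpart_mult_homogeneous[of e]) (simp_all add: hpart_hpart)
  ultimately show ?thesis by (simp add: algebra_simps hpart_diff)
qed

lemma hpart_prod:
  "finite A \<Longrightarrow> (\<And>a. a \<in> A \<Longrightarrow> deg_le (d a) (f a)) \<Longrightarrow>
    hpart (sum d A) (prod f A) = (\<Prod>a\<in>A. hpart (d a) (f a))"
  by (induction A rule: finite_induct) (auto simp: hpart_1 hpart_mult deg_le_prod)

lemma hpart_of_int_mult: "hpart d (of_int z * p) = of_int z * hpart d p"
proof -
  have "hpart 0 (of_int z :: 'a cpoly) = of_int z"
    by (metis hpart_single mdeg_0 single_of_int)
  from hpart_mult_homogeneous[OF this, of d p] show ?thesis by (simp add: mult.commute)
qed

text \<open>Each product in the Leibniz expansion has one factor per row, so its top part is the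
  product of the top parts of its factors.\<close>

lemma hpart_det:
  fixes A :: "'n::finite cpoly^'m::finite^'m"
  assumes "\<And>i j. deg_le d (A $ i $ j)"
  shows "hpart (CARD('m) * d) (det A) = det (\<chi> i j. hpart d (A $ i $ j))"
proof -
  have "hpart (CARD('m) * d) (\<Prod>i\<in>UNIV. A $ i $ \<sigma> i) = (\<Prod>i\<in>UNIV. hpart d (A $ i $ \<sigma> i))"
    for \<sigma> :: "'m \<Rightarrow> 'm"
    using hpart_prod[of "UNIV :: 'm set" "\<lambda>_. d" "\<lambda>i. A $ i $ \<sigma> i"] assms by simp
  then show ?thesis by (simp add: det_def hpart_sum hpart_of_int_mult)
qed

lemma homogeneous_iff_hpart: "homogeneous k p \<longleftrightarrow> hpart k p = p"
proof
  assume "homogeneous k p"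
  then show "hpart k p = p"
    by (intro poly_mapping_eqI) (auto simp: lookup_hpart homogeneous_def mdeg_def in_keys_iff)
next
  assume "hpart k p = p"
  then have "coeffp p m = 0" if "mdeg m \<noteq> k" for m
    using lookup_hpart[of k p m] that by simp
  then show "homogeneous k p"
    unfolding homogeneous_def by (auto simp: mdeg_def in_keys_iff)
qed

lemma homogeneous_deg_le: "homogeneous k p \<Longrightarrow> deg_le k p"
  by (metis deg_le_hpart homogeneous_iff_hpart)

lemma eval_poly_scale:
  assumes "homogeneous k p"
  shows "eval_poly p (c *s x) = c ^ k * eval_poly p x"
proof -
  have "(\<Prod>i\<in>UNIV. (c *s x) $ i ^ Poly_Mapping.lookup m i)
      = c ^ k * (\<Prod>i\<in>UNIV. x $ i ^ Poly_Mapping.lookup m i)"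
    if "m \<in> Poly_Mapping.keys p" for m
    using that assms
    by (auto simp add: homogeneous_def power_mult_distrib prod.distrib simp flip: power_sum)
  then show ?thesis
    by (simp add: eval_poly_def sum_distrib_left mult.left_commute)
qed

subsection \<open>Partial derivatives\<close>

lemma partial_add: "partial i (p + q) = partial i p + partial i q"
  unfolding partial_def
  by (rule setsum_keys_plus_distrib[where f = "\<lambda>m c. Poly_Mapping.single (m - Poly_Mapping.single i 1)
        (of_nat (Poly_Mapping.lookup m i) * c)"])
    (simp_all add: algebra_simps single_add)

lemma partial_single: "partial i (Poly_Mapping.single m c)
    = Poly_Mapping.single (m - Poly_Mapping.single i 1) (of_nat (Poly_Mapping.lookup m i) * c)"
  by (cases "c = 0") (simp_all add: partial_def)

lemma partial_0 [simp]: "partial i 0 = 0"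
  by (simp add: partial_def)

lemma partial_uminus: "partial i (- p) = - partial i p"
  using partial_add[of i p "- p"] by (simp add: eq_neg_iff_add_eq_0 add.commute)

lemma partial_diff: "partial i (p - q) = partial i p - partial i q"
  using partial_add[of i p "- q"] by (simp add: partial_uminus)

lemma partial_sum: "partial i (sum f A) = (\<Sum>a\<in>A. partial i (f a))"
  by (induction A rule: infinite_finite_induct) (simp_all add: partial_add)

lemma partial_Const [simp]: "partial i (Const c) = 0"
  by (simp add: partial_single)

lemma partial_variable: "partial i (variable j) = (if i = j then 1 else 0)"
  by (simp add: variable_def partial_single lookup_single)

text \<open>Subtraction of exponents truncates, hence the hypothesis. In the product rule the
  remaining case carries the coefficient 0.\<close>

lemma monomial_diff_add:
  fixes m m' :: "'n \<Rightarrow>\<^sub>0 nat"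
  assumes "Poly_Mapping.lookup m i > 0"
  shows "m + m' - Poly_Mapping.single i 1 = (m - Poly_Mapping.single i 1) + m'"
  using assms by (intro poly_mapping_eqI) (auto simp: lookup_add lookup_minus lookup_single when_def)

lemma partial_mult: "partial i (p * q) = partial i p * q + p * partial i q"
proof (induction p rule: poly_mapping_induct_singles)
  case (single m c)
  show ?case
  proof (induction q rule: poly_mapping_induct_singles)
    case (single m' c')
    have 1: "Poly_Mapping.single (m + m' - Poly_Mapping.single i 1) (of_nat (Poly_Mapping.lookup m i) * (c * c'))
        = Poly_Mapping.single ((m - Poly_Mapping.single i 1) + m') (of_nat (Poly_Mapping.lookup m i) * c * c')"
      by (cases "Poly_Mapping.lookup m i = 0") (simp_all add: monomial_diff_add mult.assoc del: One_nat_def)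
    have 2: "Poly_Mapping.single (m + m' - Poly_Mapping.single i 1) (of_nat (Poly_Mapping.lookup m' i) * (c * c'))
        = Poly_Mapping.single (m + (m' - Poly_Mapping.single i 1)) (c * (of_nat (Poly_Mapping.lookup m' i) * c'))"
      by (cases "Poly_Mapping.lookup m' i = 0")
        (simp_all add: monomial_diff_add[of m' i m] add.commute[of m] mult_ac del: One_nat_def)
    have "partial i (Poly_Mapping.single m c * Poly_Mapping.single m' c')
        = Poly_Mapping.single (m + m' - Poly_Mapping.single i 1) (of_nat (Poly_Mapping.lookup m i) * (c * c'))
        + Poly_Mapping.single (m + m' - Poly_Mapping.single i 1) (of_nat (Poly_Mapping.lookup m' i) * (c * c'))"
      unfolding mult_single partial_single single_add[symmetric]
      by (simp add: lookup_add distrib_right del: One_nat_def)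
    then show ?case
      unfolding 1 2 partial_single mult_single .
  qed (simp add: algebra_simps partial_add)
qed (simp add: algebra_simps partial_add)

lemma homogeneous_partial:
  assumes "homogeneous k p"
  shows "homogeneous (k - 1) (partial i p)"
proof -
  have "hpart (k - 1) (partial i (hpart k p)) = partial i (hpart k p)"
  proof (induction p rule: poly_mapping_induct_singles)
    case (single m c)
    have "mdeg m = mdeg (m - Poly_Mapping.single i 1) + 1" if "Poly_Mapping.lookup m i > 0"
    proof -
      have "m = (m - Poly_Mapping.single i 1) + Poly_Mapping.single i 1"
        using that by (intro poly_mapping_eqI) (auto simp: lookup_add lookup_minus lookup_single when_def)
      then show ?thesis by (metis mdeg_add mdeg_single)
    qed
    then show ?case
      by (cases "Poly_Mapping.lookup m i = 0") (auto simp: hpart_single partial_single)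
  qed (simp add: hpart_add partial_add)
  then show ?thesis using assms by (simp add: homogeneous_iff_hpart)
qed

text \<open>Differentiating a monomial in q_i and multiplying by q_i scales it by its exponent of
  q_i, and these exponents add up to \<open>k\<close>.\<close>

lemma euler_identity:
  assumes "homogeneous k p"
  shows "(\<Sum>i\<in>UNIV. x $ i * eval_poly (partial i p) x) = of_nat k * eval_poly p x"
proof -
  have "(\<Sum>i\<in>UNIV. x $ i * eval_poly (partial i (hpart k p)) x) = of_nat k * eval_poly (hpart k p) x"
  proof (induction p rule: poly_mapping_induct_singles)
    case (single m c)
    have "x $ i * eval_poly (partial i (Poly_Mapping.single m c)) x
        = of_nat (Poly_Mapping.lookup m i) * eval_poly (Poly_Mapping.single m c) x" for i
    proof (cases "Poly_Mapping.lookup m i = 0")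
      case False
      then have m: "m = (m - Poly_Mapping.single i 1) + Poly_Mapping.single i 1" (is "_ = ?m' + _")
        by (intro poly_mapping_eqI) (auto simp: lookup_add lookup_minus lookup_single when_def)
      have "eval_poly (Poly_Mapping.single m c) x
          = eval_poly (Poly_Mapping.single ?m' c * variable i) x"
        unfolding variable_def mult_single by (subst m) simp
      then show ?thesis
        by (simp only: eval_poly_mult partial_single eval_poly_single eval_poly_variable mult_ac)
    qed (simp add: partial_single)
    then show ?case
      by (auto simp: hpart_single mdeg_def simp flip: sum_distrib_right of_nat_sum)
  qed (simp add: hpart_add partial_add eval_poly_add algebra_simps sum.distrib)
  then show ?thesis using assms by (simp add: homogeneous_iff_hpart)
qed

section \<open>Ideals and the Nullstellensatz over the complex numbers\<close>

text \<open>A commutative ring as a module over itself: \<open>ideal.subspace\<close> says that a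
  set is an ideal, and \<open>ideal.span\<close> is the ideal generated by a set.\<close>

interpretation ideal: module "(*) :: 'a::comm_ring_1 \<Rightarrow> 'a \<Rightarrow> 'a"
  by unfold_locales (simp_all add: algebra_simps)

text \<open>As a simplification rule, \<open>scale_scale\<close> is associativity read backwards, which loops with
  \<open>mult.assoc\<close>.\<close>

declare ideal.scale_scale [simp del]

lemma ideal_span_range:
  fixes f :: "'b::finite \<Rightarrow> 'a::comm_ring_1"
  shows "x \<in> ideal.span (range f) \<longleftrightarrow> (\<exists>A. x = (\<Sum>i\<in>UNIV. A i * f i))"
proof
  have "ideal.span (range f) \<subseteq> {x. \<exists>A. x = (\<Sum>i\<in>UNIV. A i * f i)}"
  proof (rule ideal.span_minimal)
    show "range f \<subseteq> {x. \<exists>A. x = (\<Sum>i\<in>UNIV. A i * f i)}"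
    proof safe
      fix i
      show "\<exists>A. f i = (\<Sum>j\<in>UNIV. A j * f j)"
        by (rule exI[of _ "\<lambda>j. if j = i then 1 else 0"]) (simp add: if_distrib if_distribR cong: if_cong)
    qed
    show "ideal.subspace {x. \<exists>A. x = (\<Sum>i\<in>UNIV. A i * f i)}"
    proof (rule ideal.subspaceI)
      have "\<exists>A. 0 = (\<Sum>i\<in>UNIV. A i * f i)"
        by (rule exI[of _ "\<lambda>_. 0"]) simp
      moreover have "\<exists>C. (\<Sum>i\<in>UNIV. A i * f i) + (\<Sum>i\<in>UNIV. B i * f i) = (\<Sum>i\<in>UNIV. C i * f i)" for A B
        by (rule exI[of _ "\<lambda>i. A i + B i"]) (simp add: algebra_simps sum.distrib)
      moreover have "\<exists>B. c * (\<Sum>i\<in>UNIV. A i * f i) = (\<Sum>i\<in>UNIV. B i * f i)" for c A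
        by (rule exI[of _ "\<lambda>i. c * A i"]) (simp add: algebra_simps sum_distrib_left)
      ultimately show "0 \<in> {x. \<exists>A. x = (\<Sum>i\<in>UNIV. A i * f i)}"
        and "x \<in> {x. \<exists>A. x = (\<Sum>i\<in>UNIV. A i * f i)} \<Longrightarrow> y \<in> {x. \<exists>A. x = (\<Sum>i\<in>UNIV. A i * f i)}
          \<Longrightarrow> x + y \<in> {x. \<exists>A. x = (\<Sum>i\<in>UNIV. A i * f i)}"
        and "x \<in> {x. \<exists>A. x = (\<Sum>i\<in>UNIV. A i * f i)} \<Longrightarrow> c * x \<in> {x. \<exists>A. x = (\<Sum>i\<in>UNIV. A i * f i)}"
        for x y c
        by blast+
    qed
  qed
  then show "x \<in> ideal.span (range f) \<Longrightarrow> \<exists>A. x = (\<Sum>i\<in>UNIV. A i * f i)" by blast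
qed (auto intro!: ideal.span_sum ideal.span_scale[OF ideal.span_base])

section \<open>Difference quotients at a point\<close>

lemma mdeg_eq_0: "mdeg m = 0 \<Longrightarrow> m = 0"
  by (rule poly_mapping_eqI) (simp add: mdeg_def)

text \<open>One variable is split off at a time: q_i \<mu> - a_i \<mu>(a) = (q_i - a_i) \<mu> + a_i
  (\<mu> - \<mu>(a)).\<close>

lemma ex_difference_quotients_single:
  "\<exists>D. (\<forall>j. deg_le (mdeg m - 1) (D j)) \<and>
     Poly_Mapping.single m c - Const (eval_poly (Poly_Mapping.single m c) a)
       = (\<Sum>j\<in>UNIV. (variable j - Const (a $ j)) * D j)"
proof (induction "mdeg m" arbitrary: m)
  case 0
  then have "m = 0" by (simp add: mdeg_eq_0)
  then show ?case by (intro exI[of _ "\<lambda>_. 0"]) simp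
next
  case (Suc e)
  then obtain i where i: "Poly_Mapping.lookup m i > 0"
    by (metis Zero_not_Suc mdeg_def neq0_conv sum.neutral)
  define m' where "m' = m - Poly_Mapping.single i 1"
  have m: "m = Poly_Mapping.single i 1 + m'"
    unfolding m'_def using i
    by (intro poly_mapping_eqI) (auto simp: lookup_add lookup_minus lookup_single when_def)
  then have e: "e = mdeg m'" using Suc.hyps(2) by (simp add: mdeg_add)
  define \<mu> where "\<mu> = Poly_Mapping.single m' c"
  obtain D where D: "\<And>j. deg_le (e - 1) (D j)"
    and eq: "\<mu> - Const (eval_poly \<mu> a) = (\<Sum>j\<in>UNIV. (variable j - Const (a $ j)) * D j)"
    using Suc.hyps(1)[OF e] e unfolding \<mu>_def by auto
  define D' where "D' j = (if j = i then \<mu> else 0) + Const (a $ i) * D j" for j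
  have \<mu>: "Poly_Mapping.single m c = variable i * \<mu>"
    by (simp add: \<mu>_def variable_def mult_single m)
  show ?case
  proof (intro exI[of _ D'] conjI allI)
    fix j
    have "deg_le (0 + (e - 1)) (Const (a $ i) * D j)"
      by (intro deg_le_mult D) simp
    then have "deg_le e (Const (a $ i) * D j)" by (rule deg_le_mono) simp
    moreover have "deg_le e \<mu>" unfolding \<mu>_def by (rule deg_le_single) (simp add: e)
    ultimately show "deg_le (mdeg m - 1) (D' j)"
      using Suc.hyps(2)[symmetric] by (simp add: D'_def deg_le_add)
    have "Const (eval_poly (variable i * \<mu>) a) = (Const (a $ i) * Const (eval_poly \<mu> a) :: 'a cpoly)"
      by (simp add: eval_poly_mult mult_single)
    then have "variable i * \<mu> - Const (eval_poly (variable i * \<mu>) a)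
        = (variable i - Const (a $ i)) * \<mu> + Const (a $ i) * (\<mu> - Const (eval_poly \<mu> a))"
      by (simp only:) (simp add: algebra_simps)
    also have "\<dots> = (\<Sum>j\<in>UNIV. (if j = i then (variable j - Const (a $ j)) * \<mu> else 0)
        + Const (a $ i) * ((variable j - Const (a $ j)) * D j))"
      unfolding eq by (simp add: sum.distrib sum_distrib_left)
    also have "\<dots> = (\<Sum>j\<in>UNIV. (variable j - Const (a $ j)) * D' j)"
      unfolding D'_def by (rule sum.cong) (simp_all add: distrib_left mult.left_commute)
    finally show "Poly_Mapping.single m c - Const (eval_poly (Poly_Mapping.single m c) a)
        = (\<Sum>j\<in>UNIV. (variable j - Const (a $ j)) * D' j)"
      by (simp add: \<mu>)
  qed
qed

lemma ex_difference_quotients: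
  assumes "deg_le d p"
  shows "\<exists>D. (\<forall>j. deg_le (d - 1) (D j)) \<and>
     p - Const (eval_poly p a) = (\<Sum>j\<in>UNIV. (variable j - Const (a $ j)) * D j)"
proof -
  let ?s = "\<lambda>m. Poly_Mapping.single m (coeffp p m)"
  have "\<exists>D. \<forall>m. (\<forall>j. deg_le (mdeg m - 1) (D m j)) \<and>
      ?s m - Const (eval_poly (?s m) a) = (\<Sum>j\<in>UNIV. (variable j - Const (a $ j)) * D m j)"
    by (intro choice allI ex_difference_quotients_single)
  then obtain D where D: "\<And>m j. deg_le (mdeg m - 1) (D m j)"
    and eq: "\<And>m. ?s m - Const (eval_poly (?s m) a) = (\<Sum>j\<in>UNIV. (variable j - Const (a $ j)) * D m j)"
    by blast
  show ?thesis
  proof (intro exI[of _ "\<lambda>j. \<Sum>m\<in>Poly_Mapping.keys p. D m j"] conjI allI)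
    show "deg_le (d - 1) (\<Sum>m\<in>Poly_Mapping.keys p. D m j)" for j
      using assms by (intro deg_le_sum deg_le_mono[OF D]) (auto simp: deg_le_def diff_le_mono)
    have "p - Const (eval_poly p a)
        = (\<Sum>m\<in>Poly_Mapping.keys p. ?s m) - Const (\<Sum>m\<in>Poly_Mapping.keys p. eval_poly (?s m) a)"
      by (simp add: poly_mapping_sum_singles flip: eval_poly_sum)
    also have "\<dots> = (\<Sum>m\<in>Poly_Mapping.keys p. ?s m - Const (eval_poly (?s m) a))"
    proof -
      have "Const (sum g A) = (\<Sum>m\<in>A. Const (g m))" for g and A :: "('a \<Rightarrow>\<^sub>0 nat) set"
        by (induction A rule: infinite_finite_induct) (simp_all add: single_add)
      then show ?thesis by (simp add: sum_subtractf)
    qed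
    also have "\<dots> = (\<Sum>j\<in>UNIV. (variable j - Const (a $ j)) * (\<Sum>m\<in>Poly_Mapping.keys p. D m j))"
      unfolding eq sum_distrib_left by (rule sum.swap)
    finally show "p - Const (eval_poly p a)
        = (\<Sum>j\<in>UNIV. (variable j - Const (a $ j)) * (\<Sum>m\<in>Poly_Mapping.keys p. D m j))" .
  qed
qed

subsection \<open>The weak Nullstellensatz\<close>

definition poly_subst :: "'n::finite cpoly \<Rightarrow> complex poly \<Rightarrow> 'n cpoly" where
  "poly_subst u P = poly (map_poly Const P) u"

lemma poly_subst_0 [simp]: "poly_subst u 0 = 0"
  by (simp add: poly_subst_def)

lemma poly_subst_pCons: "poly_subst u (pCons c P) = Const c + u * poly_subst u P"
  by (simp add: poly_subst_def map_poly_pCons)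

lemma poly_subst_add: "poly_subst u (P + Q) = poly_subst u P + poly_subst u Q"
proof -
  have "map_poly Const (P + Q) = map_poly Const P + (map_poly Const Q :: 'a cpoly poly)"
    by (rule poly_eqI) (simp add: coeff_map_poly single_add)
  then show ?thesis by (simp add: poly_subst_def)
qed

lemma poly_subst_smult: "poly_subst u (smult c P) = Const c * poly_subst u P"
proof -
  have "map_poly Const (smult c P) = smult (Const c) (map_poly Const P :: 'a cpoly poly)"
    by (rule poly_eqI) (simp add: coeff_map_poly mult_single)
  then show ?thesis by (simp add: poly_subst_def)
qed

lemma poly_subst_mult: "poly_subst u (P * Q) = poly_subst u P * poly_subst u Q"
  by (induction P)
    (simp_all add: poly_subst_pCons poly_subst_add poly_subst_smult algebra_simps)

lemma poly_subst_linear: "poly_subst u [:- c, 1:] = u - Const c"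
  by (simp add: poly_subst_pCons single_uminus)

lemma poly_subst_sum: "poly_subst u (sum f A) = (\<Sum>a\<in>A. poly_subst u (f a))"
  by (induction A rule: infinite_finite_induct) (simp_all add: poly_subst_add)

lemma poly_subst_prod: "poly_subst u (prod f A) = (\<Prod>a\<in>A. poly_subst u (f a))"
proof -
  have "poly_subst u 1 = 1"
    unfolding one_pCons by (simp add: poly_subst_pCons)
  then show ?thesis
    by (induction A rule: infinite_finite_induct) (simp_all add: poly_subst_mult)
qed

text \<open>Over the complex numbers \<open>P\<close> splits into linear factors; each becomes a
  unit modulo \<open>J\<close>, and products of units are units.\<close>

lemma poly_subst_unit_mod:
  assumes J: "ideal.subspace J"
    and unit: "\<And>c. \<exists>r. 1 - r * (u - Const c) \<in> J"
    and "P \<noteq> 0"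
  shows "\<exists>r. 1 - r * poly_subst u P \<in> J"
  using \<open>P \<noteq> 0\<close>
proof (induction "degree P" arbitrary: P)
  case 0
  then obtain c where "P = [:c:]" "c \<noteq> 0"
    by (metis degree_eq_zeroE pCons_0_0)
  then show ?case
    by (intro exI[of _ "Const (inverse c)"])
      (simp add: poly_subst_pCons mult_single ideal.subspace_0[OF J])
next
  case (Suc d)
  then obtain e where "poly P e = 0"
    using fundamental_theorem_of_algebra_alt[of P] by (metis degree_pCons_0 nat.distinct(1))
  then obtain Q where P: "P = [:- e, 1:] * Q"
    using poly_eq_0_iff_dvd by (metis dvdE)
  with Suc.prems have "Q \<noteq> 0" by auto
  with P have "degree P = degree Q + 1"
    unfolding P by (subst degree_mult_eq) simp_all
  with Suc.hyps(1)[of Q] Suc.hyps(2) \<open>Q \<noteq> 0\<close> obtain r where r: "1 - r * poly_subst u Q \<in> J"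
    by auto
  obtain s where s: "1 - s * (u - Const e) \<in> J" using unit by blast
  have "(1 - r * poly_subst u Q) + r * poly_subst u Q * (1 - s * (u - Const e)) \<in> J"
    by (intro ideal.subspace_add[OF J] ideal.subspace_scale[OF J] r s)
  also have "(1 - r * poly_subst u Q) + r * poly_subst u Q * (1 - s * (u - Const e))
      = 1 - r * s * poly_subst u P"
    unfolding P poly_subst_mult poly_subst_linear by (simp add: algebra_simps)
  finally show ?case by blast
qed

text \<open>The polynomial ring as a complex vector space, for the dimension count below.\<close>

interpretation cpoly: vector_space "\<lambda>c (p :: 'n::finite cpoly). Const c * p"
  by unfold_locales (simp_all add: algebra_simps single_add mult_single flip: mult.assoc)

declare cpoly.scale_scale [simp del]

lemma deg_le_in_span:
  assumes "deg_le d p"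
  shows "p \<in> cpoly.span ((\<lambda>m. Poly_Mapping.single m 1) ` {m. mdeg m \<le> d})"
proof -
  have "(\<Sum>m\<in>Poly_Mapping.keys p. Const (coeffp p m) * Poly_Mapping.single m 1)
      \<in> cpoly.span ((\<lambda>m. Poly_Mapping.single m 1) ` {m. mdeg m \<le> d})"
    using assms by (intro cpoly.span_sum cpoly.span_scale cpoly.span_base) (auto simp: deg_le_def)
  then show ?thesis by (simp add: mult_single poly_mapping_sum_singles)
qed

text \<open>If \<open>u - c\<close> were invertible modulo \<open>J\<close> for every \<open>c\<close>, the uncountably many inverses would be
  linearly dependent, as the polynomial ring has countable dimension. Clearing denominators, a
  nonzero univariate polynomial in \<open>u\<close> lies in \<open>J\<close>, although it is a product of units modulo \<open>J\<close>.\<close>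

lemma ex_proper_ideal_insert:
  assumes J: "ideal.subspace J" and proper: "1 \<notin> J"
  shows "\<exists>c. 1 \<notin> ideal.span (insert (u - Const c) J)"
proof (rule ccontr)
  assume "\<not> ?thesis"
  then have unit: "\<exists>r. 1 - r * (u - Const c) \<in> J" for c
    using J by (simp add: ideal.span_insert ideal.span_eq_iff[THEN iffD2])
  then obtain r where r: "\<And>c. 1 - r c * (u - Const c) \<in> J" by metis
  \<comment> \<open>An inverse shared by two differences \<open>u - Const c\<close> and
    \<open>u - Const c'\<close> would lie in \<open>J\<close>, as subtracting the two congruences
    shows, and then so would 1.\<close>
  have "inj r"
  proof (rule injI, rule ccontr)
    fix c c' assume eq: "r c = r c'" and "c \<noteq> c'"
    have "(1 - r c * (u - Const c)) - (1 - r c * (u - Const c')) \<in> J"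
      using r[of c] r[of c'] eq by (metis ideal.subspace_diff[OF J])
    then have "r c * Const (c - c') \<in> J" by (simp add: algebra_simps single_diff)
    then have "(u - Const c) * Const (inverse (c - c')) * (r c * Const (c - c')) \<in> J"
      by (rule ideal.subspace_scale[OF J])
    also have "(u - Const c) * Const (inverse (c - c')) * (r c * Const (c - c'))
        = r c * (u - Const c) * (Const (inverse (c - c')) * Const (c - c'))"
      by (simp only: mult_ac)
    also have "\<dots> = r c * (u - Const c)"
      using \<open>c \<noteq> c'\<close> by (simp add: mult_single)
    finally have "(1 - r c * (u - Const c)) + r c * (u - Const c) \<in> J"
      by (intro ideal.subspace_add[OF J] r)
    with proper show False by simp
  qed
  \<comment> \<open>Countably many degree bounds cover uncountably many \<open>c\<close>, so one
    bound serves infinitely many inverses. These lie in a finite-dimensional space.\<close>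
  have "\<exists>d. infinite {c. deg_le d (r c)}"
  proof (rule ccontr)
    assume "\<not> ?thesis"
    then have "countable (\<Union>d. {c. deg_le d (r c)})"
      by (intro countable_UN) (auto intro: countable_finite)
    moreover have "(\<Union>d. {c. deg_le d (r c)}) = UNIV"
      using ex_deg_le by auto
    ultimately show False using uncountable_UNIV_complex by simp
  qed
  then obtain d where inf: "infinite {c. deg_le d (r c)}" by blast
  let ?C = "{c. deg_le d (r c)}"
  have "infinite (r ` ?C)"
    using inf \<open>inj r\<close> by (meson finite_imageD inj_on_subset subset_UNIV)
  moreover have "r ` ?C \<subseteq> cpoly.span ((\<lambda>m. Poly_Mapping.single m 1) ` {m. mdeg m \<le> d})"
    using deg_le_in_span by auto
  ultimately have "cpoly.dependent (r ` ?C)"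
    using cpoly.independent_span_bound[OF finite_imageI[OF finite_mdeg_le]] by blast
  then obtain t w v where t: "finite t" "t \<subseteq> r ` ?C" "(\<Sum>v\<in>t. Const (w v) * v) = 0"
    and v: "v \<in> t" "w v \<noteq> 0"
    unfolding cpoly.dependent_explicit by blast
  obtain T where T: "T \<subseteq> ?C" "finite T" "t = r ` T"
    using finite_subset_image[OF t(1,2)] by blast
  obtain c0 where c0: "c0 \<in> T" "w (r c0) \<noteq> 0" using v T by auto
  have dep: "(\<Sum>c\<in>T. Const (w (r c)) * r c) = 0"
    using t(3) \<open>inj r\<close> unfolding T(3) by (subst (asm) sum.reindex) (auto intro: inj_on_subset)
  \<comment> \<open>Modulo \<open>J\<close> the linear relation reads \<Sum> w_c / (u - c) = 0, and
    \<open>P\<close> is its numerator over the common denominator. At \<open>c0\<close> only the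
    summand for \<open>c0\<close> survives, so \<open>P\<close> is nonzero.\<close>
  define P where "P = (\<Sum>c\<in>T. smult (w (r c)) (\<Prod>c'\<in>T - {c}. [:- c', 1:]))"
  have "poly P c0 = (\<Sum>c\<in>T. if c = c0 then w (r c) * (\<Prod>c'\<in>T - {c}. c0 - c') else 0)"
    unfolding P_def poly_sum
    by (rule sum.cong) (use T c0 in \<open>auto simp: poly_prod\<close>)
  also have "\<dots> \<noteq> 0" using T c0 by (simp)
  finally have "P \<noteq> 0" by auto
  \<comment> \<open>The subtracted term is 0 by the linear relation; with it each summand becomes a
    multiple of an element \<open>1 - r c * (u - Const c)\<close> of \<open>J\<close>.\<close>
  have "poly_subst u P = poly_subst u P - (\<Prod>c\<in>T. u - Const c) * (\<Sum>c\<in>T. Const (w (r c)) * r c)"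
    by (simp add: dep)
  also have "\<dots> = (\<Sum>c\<in>T. Const (w (r c)) * (\<Prod>c'\<in>T - {c}. u - Const c') * (1 - r c * (u - Const c)))"
    unfolding P_def poly_subst_sum poly_subst_smult poly_subst_prod poly_subst_linear
      sum_distrib_left sum_subtractf[symmetric]
  proof (rule sum.cong[OF refl])
    fix c assume "c \<in> T"
    then have "(\<Prod>c\<in>T. u - Const c) = (u - Const c) * (\<Prod>c'\<in>T - {c}. u - Const c')"
      using T by (simp add: prod.remove)
    then show "Const (w (r c)) * (\<Prod>c'\<in>T - {c}. u - Const c') - (\<Prod>c\<in>T. u - Const c) * (Const (w (r c)) * r c)
        = Const (w (r c)) * (\<Prod>c'\<in>T - {c}. u - Const c') * (1 - r c * (u - Const c))"
      by (simp only:) (simp add: algebra_simps)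
  qed
  also have "\<dots> \<in> J"
    by (intro ideal.subspace_sum[OF J] ideal.subspace_scale[OF J] r)
  finally have PJ: "poly_subst u P \<in> J" .
  obtain s where "1 - s * poly_subst u P \<in> J"
    using poly_subst_unit_mod[OF J unit \<open>P \<noteq> 0\<close>] by blast
  then have "(1 - s * poly_subst u P) + s * poly_subst u P \<in> J"
    by (intro ideal.subspace_add[OF J] ideal.subspace_scale[OF J] PJ)
  with proper show False by simp
qed

text \<open>Differences q_j - c_j are adjoined one variable at a time, keeping the ideal proper.
  Every \<open>f\<close> is then congruent to its value at the point with coordinates
  \<open>c j\<close>; for \<open>f\<close> in \<open>S\<close> a nonzero value would be a unit in
  \<open>J\<close>.\<close>

theorem weak_nullstellensatz:
  fixes S :: "'n::finite cpoly set"
  assumes "1 \<notin> ideal.span S"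
  shows "\<exists>a. \<forall>f\<in>S. eval_poly f a = 0"
proof -
  have "\<exists>J c. ideal.subspace J \<and> S \<subseteq> J \<and> 1 \<notin> J \<and> (\<forall>j\<in>A. variable j - Const (c j) \<in> J)"
    if "finite A" for A :: "'n set"
    using that
  proof (induction A)
    case empty
    show ?case
    proof (intro exI conjI)
      show "ideal.subspace (ideal.span S)" by (rule ideal.subspace_span)
      show "S \<subseteq> ideal.span S" by (rule ideal.span_superset)
    qed (use assms in simp_all)
  next
    case (insert j A)
    then obtain J c where J: "ideal.subspace J" "S \<subseteq> J" "1 \<notin> J"
      and A: "\<forall>j\<in>A. variable j - Const (c j) \<in> J" by blast
    obtain b where b: "1 \<notin> ideal.span (insert (variable j - Const b) J)"
      using ex_proper_ideal_insert[OF J(1,3), of "variable j"] by (elim exE)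
    have sup: "insert (variable j - Const b) J \<subseteq> ideal.span (insert (variable j - Const b) J)"
      by (rule ideal.span_superset)
    show ?case
    proof (intro exI[of _ "ideal.span (insert (variable j - Const b) J)"] exI[of _ "c(j := b)"] conjI ballI)
      show "S \<subseteq> ideal.span (insert (variable j - Const b) J)"
        using sup J(2) by blast
      fix i assume "i \<in> insert j A"
      then show "variable i - Const ((c(j := b)) i) \<in> ideal.span (insert (variable j - Const b) J)"
        using sup A by (cases "i = j") auto
    qed (use b in auto)
  qed
  from this[OF finite[of UNIV]] obtain J c where J: "ideal.subspace J" "S \<subseteq> J" "1 \<notin> J"
    and c': "\<forall>j\<in>UNIV. variable j - Const (c j) \<in> J" by (elim exE conjE)
  note c = bspec[OF c' UNIV_I]
  define a where "a = (\<chi> j. c j)"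
  have "eval_poly f a = 0" if "f \<in> S" for f
  proof (rule ccontr)
    assume nz: "eval_poly f a \<noteq> 0"
    obtain d where "deg_le d f" using ex_deg_le by blast
    then obtain D where D: "f - Const (eval_poly f a) = (\<Sum>j\<in>UNIV. (variable j - Const (a $ j)) * D j)"
      using ex_difference_quotients[of d f a] by blast
    have "(\<Sum>j\<in>UNIV. D j * (variable j - Const (a $ j))) \<in> J"
      by (intro ideal.subspace_sum[OF J(1)] ideal.subspace_scale[OF J(1)]) (simp add: a_def c)
    then have "f - Const (eval_poly f a) \<in> J" unfolding D by (simp only: mult.commute)
    with J(2) that have "f - (f - Const (eval_poly f a)) \<in> J"
      by (meson ideal.subspace_diff[OF J(1)] subsetD)
    then have "Const (eval_poly f a) \<in> J" by simp
    then have "Const (inverse (eval_poly f a)) * Const (eval_poly f a) \<in> J"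
      by (rule ideal.subspace_scale[OF J(1)])
    with nz J(3) show False by (simp add: mult_single)
  qed
  then show ?thesis by blast
qed

text \<open>The forms and q_j - 1 have no common zero, so they generate 1. Comparing homogeneous
  parts in B = B q_j + \<Sum> A_i H_i - 1 shows that the part of B of degree d is -q_j^d modulo the
  forms; it vanishes once d exceeds the degree of B.\<close>

lemma ex_variable_power_combination:
  fixes H :: "'a::finite \<Rightarrow> 'n::finite cpoly"
  assumes H: "\<And>i. hpart m (H i) = H i"
    and zeros: "\<And>x. (\<And>i. eval_poly (H i) x = 0) \<Longrightarrow> x = 0"
  shows "\<exists>M\<ge>m. \<exists>A. (\<forall>i. deg_le (M - m) (A i)) \<and> variable j ^ M = (\<Sum>i\<in>UNIV. A i * H i)"
proof -
  have "1 \<in> ideal.span (insert (variable j - 1) (range H))"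
  proof (rule ccontr)
    assume "\<not> ?thesis"
    then obtain a where a: "\<forall>f\<in>insert (variable j - 1) (range H). eval_poly f a = 0"
      using weak_nullstellensatz by blast
    then have "a = 0" by (intro zeros) auto
    with a show False by (simp add: eval_poly_diff)
  qed
  then obtain A B where "1 - B * (variable j - 1) = (\<Sum>i\<in>UNIV. A i * H i)"
    by (auto simp: ideal.span_insert ideal_span_range)
  then have AB: "B = B * variable j + (\<Sum>i\<in>UNIV. A i * H i) - 1"
    by (simp add: algebra_simps)
  \<comment> \<open>The part of \<open>A i\<close> that contributes to degree \<open>d\<close> of
    \<open>A i * H i\<close>; for \<open>d < m\<close>, where \<open>d - m\<close> would truncate,
    it is 0.\<close>
  define X where "X d i = (if m \<le> d then hpart (d - m) (A i) else 0)" for d i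
  have X: "mdeg e + m \<le> d" if "e \<in> Poly_Mapping.keys (X d i)" for d i e
    using that by (auto simp: X_def in_keys_iff lookup_hpart split: if_splits)
  have hA: "hpart d (A i * H i) = X d i * H i" for d i
    by (simp add: hpart_mult_homogeneous[OF H] X_def)
  have "hpart 1 (variable j) = variable j"
    by (simp add: variable_def hpart_single)
  note hB = hpart_mult_homogeneous[OF this]
  \<comment> \<open>With \<open>m\<close> added on the left instead of subtracted on the right, the
    bound forces \<open>C i = 0\<close> for \<open>d < m\<close>.\<close>
  have "\<exists>C. (\<forall>i. \<forall>e\<in>Poly_Mapping.keys (C i). mdeg e + m \<le> d) \<and>
      hpart d B = (\<Sum>i\<in>UNIV. C i * H i) - variable j ^ d" for d
  proof (induction d)
    case 0
    have "hpart 0 B = (\<Sum>i\<in>UNIV. X 0 i * H i) - 1"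
      by (subst AB) (simp add: hpart_add hpart_diff hpart_sum hA hB hpart_1)
    then show ?case using X[where d = 0] by (intro exI[of _ "X 0"]) simp
  next
    case (Suc d)
    then obtain C where C: "\<And>i e. e \<in> Poly_Mapping.keys (C i) \<Longrightarrow> mdeg e + m \<le> d"
      and hd: "hpart d B = (\<Sum>i\<in>UNIV. C i * H i) - variable j ^ d" by blast
    have "hpart (Suc d) B = hpart (Suc d) (B * variable j + (\<Sum>i\<in>UNIV. A i * H i) - 1)"
      using AB by (rule arg_cong)
    also have "\<dots> = hpart d B * variable j + (\<Sum>i\<in>UNIV. X (Suc d) i * H i)"
      by (simp add: hpart_add hpart_diff hpart_sum hA hB hpart_1)
    also have "\<dots> = (\<Sum>i\<in>UNIV. (X (Suc d) i + C i * variable j) * H i) - variable j ^ Suc d"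
      unfolding hd by (simp add: algebra_simps sum.distrib sum_distrib_left)
    finally have eq: "hpart (Suc d) B = (\<Sum>i\<in>UNIV. (X (Suc d) i + C i * variable j) * H i) - variable j ^ Suc d" .
    have "mdeg e + m \<le> Suc d" if "e \<in> Poly_Mapping.keys (X (Suc d) i + C i * variable j)" for i e
    proof (cases "e \<in> Poly_Mapping.keys (X (Suc d) i)")
      case False
      then have "e \<in> Poly_Mapping.keys (C i * variable j)"
        using that keys_add[of "X (Suc d) i" "C i * variable j"] by blast
      then obtain e' where "e' \<in> Poly_Mapping.keys (C i)" "e = e' + Poly_Mapping.single j 1"
        using keys_mult[of "C i" "variable j"] by (auto simp: variable_def)
      then show ?thesis using C[of e' i] by (simp add: mdeg_add)
    qed (use X in auto)
    then show ?case
      by (intro exI[of _ "\<lambda>i. X (Suc d) i + C i * variable j"] conjI allI ballI eq)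
  qed
  moreover obtain b where b: "deg_le b B" using ex_deg_le by blast
  ultimately obtain C where C: "\<And>i e. e \<in> Poly_Mapping.keys (C i) \<Longrightarrow> mdeg e + m \<le> Suc (b + m)"
    and hd: "hpart (Suc (b + m)) B = (\<Sum>i\<in>UNIV. C i * H i) - variable j ^ Suc (b + m)" by blast
  have "hpart (Suc (b + m)) B = 0" by (rule hpart_eq_0[OF b]) simp
  with hd have "variable j ^ Suc (b + m) = (\<Sum>i\<in>UNIV. C i * H i)" by simp
  moreover have "deg_le (Suc (b + m) - m) (C i)" for i
    unfolding deg_le_def by (metis C add_le_imp_le_diff)
  ultimately show ?thesis
    by (intro exI[of _ "Suc (b + m)"] exI[of _ C] conjI allI) simp_all
qed

text \<open>Multiplying each relation by a further power of its variable makes the exponent the same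
  for all variables.\<close>

lemma ex_variable_powers_combination:
  fixes H :: "'a::finite \<Rightarrow> 'n::finite cpoly"
  assumes H: "\<And>i. hpart m (H i) = H i"
    and zeros: "\<And>x. (\<And>i. eval_poly (H i) x = 0) \<Longrightarrow> x = 0"
  shows "\<exists>M\<ge>m. \<exists>A. (\<forall>j i. deg_le (M - m) (A j i)) \<and> (\<forall>j. variable j ^ M = (\<Sum>i\<in>UNIV. A j i * H i))"
proof -
  have "\<exists>M A. M \<ge> m \<and> (\<forall>i. deg_le (M - m) (A i)) \<and> variable j ^ M = (\<Sum>i\<in>UNIV. A i * H i)" for j
    using ex_variable_power_combination[where H = H and m = m and j = j] assms by blast
  then obtain M A where M: "\<And>j. M j \<ge> m" and A: "\<And>j i. deg_le (M j - m) (A j i)"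
    and eq: "\<And>j. variable j ^ M j = (\<Sum>i\<in>UNIV. A j i * H i)"
    by metis
  define N where "N = m + (\<Sum>j\<in>UNIV. M j)"
  have N: "M j \<le> N" for j
    unfolding N_def by (rule trans_le_add2) (rule member_le_sum, auto)
  show ?thesis
  proof (intro exI[of _ N] conjI exI[of _ "\<lambda>j i. variable j ^ (N - M j) * A j i"] allI)
    show "m \<le> N" by (simp add: N_def)
    fix j
    have "variable j ^ N = variable j ^ (N - M j) * variable j ^ M j"
      using N[of j] by (simp flip: power_add)
    then show "variable j ^ N = (\<Sum>i\<in>UNIV. variable j ^ (N - M j) * A j i * H i)"
      by (simp add: eq sum_distrib_left mult.assoc)
    fix i
    have "deg_le ((N - M j) * 1 + (M j - m)) (variable j ^ (N - M j) * A j i)"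
      by (intro deg_le_mult deg_le_power A deg_le_variable) simp
    then show "deg_le (N - m) (variable j ^ (N - M j) * A j i)"
      using N[of j] M[of j] by simp
  qed
qed

section \<open>The Euler--Jacobi vanishing theorem\<close>

subsection \<open>Cramer's rule over a commutative ring\<close>

text \<open>Expanding row \<open>k\<close> by linearity leaves only the term \<open>j = k\<close>,
  since the others have two equal rows. Nothing is divided, so matrices of polynomials are
  covered.\<close>

lemma cramer_transpose_comm_ring:
  fixes A :: "'a::comm_ring_1^'n::finite^'n"
  shows "det (\<chi> i. if i = k then \<Sum>j\<in>UNIV. x $ j *s row j A else row i A) = x $ k * det A"
proof -
  have "det (\<chi> i. if i = k then \<Sum>j\<in>UNIV. x $ j *s row j A else row i A)
      = (\<Sum>j\<in>UNIV. x $ j * det (\<chi> i. if i = k then row j A else row i A))"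
    by (simp add: det_linear_row_sum det_row_mul)
  also have "\<dots> = (\<Sum>j\<in>UNIV. if j = k then x $ k * det A else 0)"
  proof (rule sum.cong[OF refl])
    fix j
    show "x $ j * det (\<chi> i. if i = k then row j A else row i A) = (if j = k then x $ k * det A else 0)"
    proof (cases "j = k")
      case True
      then have "(\<chi> i. if i = k then row j A else row i A) = A"
        by (simp add: vec_eq_iff row_def)
      with True show ?thesis by simp
    next
      case False
      then have "det (\<chi> i. if i = k then row j A else row i A) = 0"
        by (intro det_identical_rows[of j k]) (simp_all add: row_def)
      with False show ?thesis by simp
    qed
  qed
  finally show ?thesis by simp
qed

text \<open>Adjugate form of Cramer's rule: \<open>det A\<close> times any entry of \<open>x\<close>
  lies in the ideal generated by the entries of \<open>A *v x\<close>. The \<open>c j\<close> are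
  cofactors.\<close>

lemma ex_cramer_comm_ring:
  fixes A :: "'a::comm_ring_1^'n::finite^'n"
  shows "\<exists>c. x $ k * det A = (\<Sum>j\<in>UNIV. c j * (A *v x) $ j)"
proof -
  define R where "R i = row i (transpose A)" for i
  have "A *v x = (\<Sum>j\<in>UNIV. x $ j *s R j)"
    by (simp add: R_def vec_eq_iff matrix_vector_mult_def row_def transpose_def mult.commute)
  moreover have "A *v x = (\<Sum>j\<in>UNIV. (A *v x) $ j *s axis j 1)"
    by (simp add: vec_eq_iff axis_def if_distrib[of "\<lambda>y. _ * y"] cong: if_cong)
  ultimately have "x $ k * det (transpose A)
      = det (\<chi> i. if i = k then \<Sum>j\<in>UNIV. (A *v x) $ j *s axis j 1 else R i)"
    using cramer_transpose_comm_ring[of k x "transpose A"] unfolding R_def by metis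
  also have "\<dots> = (\<Sum>j\<in>UNIV. (A *v x) $ j * det (\<chi> i. if i = k then axis j 1 else R i))"
    by (simp add: det_linear_row_sum det_row_mul)
  finally show ?thesis
    by (intro exI[of _ "\<lambda>j. det (\<chi> i. if i = k then axis j 1 else R i)"])
      (simp add: mult.commute)
qed

section \<open>Monomials and coefficients at infinity\<close>

definition mon :: "('n::finite \<Rightarrow> nat) \<Rightarrow> 'n \<Rightarrow>\<^sub>0 nat" where
  "mon f = Abs_poly_mapping f"

lemma lookup_mon [simp]: "Poly_Mapping.lookup (mon f) = f"
  by (simp add: mon_def)

lemma mdeg_mon: "mdeg (mon f) = sum f UNIV"
  by (simp add: mdeg_def)

lemma variable_power: "variable j ^ e = Poly_Mapping.single (Poly_Mapping.single j e) 1"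
  by (induction e) (simp_all add: variable_def mult_single single_add[symmetric])

lemma prod_variable_power: "(\<Prod>i\<in>UNIV. variable i ^ f i) = Poly_Mapping.single (mon f) 1"
proof -
  have "(\<Prod>i\<in>A. variable i ^ f i) = Poly_Mapping.single (\<Sum>i\<in>A. Poly_Mapping.single i (f i)) 1"
    if "finite A" for A
    using that by (induction A) (simp_all add: variable_power mult_single)
  moreover have "(\<Sum>i\<in>UNIV. Poly_Mapping.single i (f i)) = mon f"
    by (rule poly_mapping_eqI) (simp add: lookup_sum lookup_single when_def)
  ultimately show ?thesis by simp
qed

lemma lookup_mult_variable_power:
  "coeffp (p * variable j ^ e) m
    = (if e \<le> Poly_Mapping.lookup m j then coeffp p (m - Poly_Mapping.single j e) else 0)"
proof (induction p rule: poly_mapping_induct_singles)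
  case (single m' c)
  have "m' + Poly_Mapping.single j e = m \<longleftrightarrow> e \<le> Poly_Mapping.lookup m j \<and> m' = m - Poly_Mapping.single j e"
    by (auto simp: poly_mapping_eq_iff fun_eq_iff lookup_add lookup_minus lookup_single when_def)
  then show ?case
    by (auto simp: variable_power mult_single lookup_single when_def)
qed (simp add: algebra_simps lookup_add)

text \<open>Replacing the rows of \<open>B\<close> one at a time by those of the diagonal matrix with entries
  \<open>y\<^sub>i ^ (M - 1)\<close> does not change the coefficient: the difference is the determinant of a matrix
  mapping \<open>y\<close> to a vector with \<open>i\<close>-th entry \<open>0\<close> and the others \<open>y\<^sub>r ^ M\<close>, so by Cramer's rule \<open>y\<^sub>i\<close>
  times it is a combination of the \<open>y\<^sub>r ^ M\<close> with \<open>r \<noteq> i\<close>.\<close>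

lemma coeff_det_of_variable_powers:
  fixes B :: "'n::finite cpoly^'n^'n"
  assumes B: "\<And>i. (\<Sum>j\<in>UNIV. B $ i $ j * variable j) = variable i ^ M" and "M \<ge> 1"
  shows "coeffp (det B) (mon (\<lambda>_. M - 1)) = 1"
proof -
  define E :: "'n \<Rightarrow> 'n cpoly^'n" where "E i = (\<chi> j. if j = i then variable i ^ (M - 1) else 0)" for i
  define C where "C S = (\<chi> i. if i \<in> S then E i else B $ i)" for S
  have E: "(\<Sum>j\<in>UNIV. E i $ j * variable j) = variable i ^ M" for i
    using \<open>M \<ge> 1\<close> power_minus_mult[of M "variable i"]
    by (simp add: E_def if_distrib[of "\<lambda>x. x * _"] cong: if_cong)
  have step: "coeffp (det (C (insert i S))) (mon (\<lambda>_. M - 1)) = coeffp (det (C S)) (mon (\<lambda>_. M - 1))"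
    if "i \<notin> S" for i S
  proof -
    define C' where "C' = (\<chi> r. if r = i then B $ i - E i else C S $ r)"
    have "det (\<chi> r. if r = i then (B $ i - E i) + E i else C S $ r)
        = det C' + det (\<chi> r. if r = i then E i else C S $ r)"
      unfolding C'_def by (rule det_row_add)
    moreover have "(\<chi> r. if r = i then (B $ i - E i) + E i else C S $ r) = C S"
      using that by (simp add: vec_eq_iff C_def)
    moreover have "(\<chi> r. if r = i then E i else C S $ r) = C (insert i S)"
      by (simp add: vec_eq_iff C_def)
    ultimately have eq: "det (C S) = det C' + det (C (insert i S))" by simp
    obtain c where c: "(\<chi> j. variable j) $ i * det C' = (\<Sum>r\<in>UNIV. c r * (C' *v (\<chi> j. variable j)) $ r)"
      using ex_cramer_comm_ring by blast
    have "(C' *v (\<chi> j. variable j)) $ r = (if r = i then 0 else variable r ^ M)" for r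
      using B[of r] B[of i] E[of r] E[of i]
      by (simp add: C'_def C_def matrix_vector_mult_def left_diff_distrib sum_subtractf)
    with c have c': "det C' * variable i ^ 1 = (\<Sum>r\<in>UNIV. if r = i then 0 else c r * variable r ^ M)"
      by (simp add: mult.commute if_distrib[of "\<lambda>x. _ * x"] cong: if_cong)
    \<comment> \<open>The target monomial times y_i. Its exponents in the other variables are
      \<open>M - 1\<close>, so it occurs in no multiple of y_r ^ M with r \<noteq> i.\<close>
    let ?m = "mon ((\<lambda>_. M - 1)(i := M))"
    have "coeffp (det C' * variable i ^ 1) ?m = 0"
      unfolding c' lookup_sum
      using \<open>M \<ge> 1\<close> by (intro sum.neutral) (auto simp: lookup_mult_variable_power)
    moreover have "?m - Poly_Mapping.single i 1 = mon (\<lambda>_. M - 1)"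
      by (rule poly_mapping_eqI) (simp add: lookup_minus lookup_single when_def)
    ultimately have "coeffp (det C') (mon (\<lambda>_. M - 1)) = 0"
      using \<open>M \<ge> 1\<close> unfolding lookup_mult_variable_power by simp
    then show ?thesis by (simp add: eq lookup_add)
  qed
  have "coeffp (det (C S)) (mon (\<lambda>_. M - 1)) = coeffp (det (C {})) (mon (\<lambda>_. M - 1))"
    if "finite S" for S
    using that by (induction S) (simp_all add: step del: One_nat_def)
  from this[of UNIV]
  have "coeffp (det (C UNIV)) (mon (\<lambda>_. M - 1)) = coeffp (det B) (mon (\<lambda>_. M - 1))"
    by (simp add: C_def)
  moreover have "det (C UNIV) = (\<Prod>i\<in>UNIV. variable i ^ (M - 1))"
    by (subst det_diagonal) (simp_all add: C_def E_def)
  ultimately show ?thesis by (simp add: prod_variable_power)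
qed

text \<open>The residue at infinity of \<open>h / \<Prod>\<^sub>j (y\<^sub>j ^ M + l\<^sub>j)\<close>, i.e. the coefficient of \<open>\<Prod>\<^sub>j y\<^sub>j ^ (-1)\<close> in the
  geometric expansion in the \<open>- l\<^sub>j / y\<^sub>j ^ M\<close>, is the sum over \<open>k\<close> of the coefficients of
  \<open>\<Prod>\<^sub>j y\<^sub>j ^ (M (k\<^sub>j + 1) - 1)\<close> in \<open>h \<Prod>\<^sub>j (- l\<^sub>j) ^ k\<^sub>j\<close>. It vanishes on the ideal of the \<open>y\<^sub>j ^ M + l\<^sub>j\<close> by
  telescoping. For \<open>h\<close> of degree at most \<open>n (M - 1)\<close> only the term \<open>k = 0\<close> is left.\<close>

lemma coeff_eq_0_of_combination:
  fixes l :: "'n::finite \<Rightarrow> 'n cpoly"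
  assumes "M \<ge> 1" and l: "\<And>j. deg_le (M - 1) (l j)"
    and h: "h = (\<Sum>j\<in>UNIV. A j * (variable j ^ M + l j))"
    and deg: "deg_le (CARD('n) * (M - 1)) h"
  shows "coeffp h (mon (\<lambda>_. M - 1)) = 0"
proof -
  define W where "W k = (\<Prod>j\<in>UNIV. (- l j) ^ k j)" for k :: "'n \<Rightarrow> nat"
  define E where "E k = mon (\<lambda>j. M * k j + (M - 1))" for k :: "'n \<Rightarrow> nat"
  have "\<forall>j. \<exists>d. deg_le d (A j)" using ex_deg_le by blast
  then obtain d where d: "\<And>j. deg_le (d j) (A j)" by metis
  \<comment> \<open>The residue is truncated to a finite box, large enough for the terms on its
    outer faces to vanish by degree.\<close>
  define K where "K = (\<Sum>j\<in>UNIV. d j) + M"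
  define Box where "Box = (PiE UNIV (\<lambda>_. {..K}) :: ('n \<Rightarrow> nat) set)"
  have finBox: "finite Box" unfolding Box_def by (rule finite_PiE) auto
  have Box: "k \<in> Box \<longleftrightarrow> (\<forall>j. k j \<le> K)" for k
    by (auto simp: Box_def PiE_UNIV_domain)
  have degW: "deg_le (sum k UNIV * (M - 1)) (W k)" for k
    unfolding W_def sum_distrib_right by (intro deg_le_prod deg_le_power deg_le_uminus l)
  have mdegE: "mdeg (E k) = M * sum k UNIV + CARD('n) * (M - 1)" for k
    by (simp add: E_def mdeg_mon sum.distrib sum_distrib_left)
  have M: "M * s = s * (M - 1) + s" for s
    using \<open>M \<ge> 1\<close> by (cases M) simp_all
  have van: "coeffp (p * W k') (E k) = 0"
    if "deg_le e p" "e + sum k' UNIV * (M - 1) < M * sum k UNIV + CARD('n) * (M - 1)" for p e k k'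
    using deg_leD[OF deg_le_mult[OF that(1) degW]] that(2) mdegE by simp
  have "(\<Sum>k\<in>Box. coeffp (A j * (variable j ^ M + l j) * W k) (E k)) = 0" for j
  proof -
    \<comment> \<open>Raising \<open>k j\<close> by one multiplies \<open>W\<close> by
      \<open>- l j\<close>. So the term for \<open>k\<close> is \<open>T\<close> at the predecessor
      of \<open>k\<close> in direction \<open>j\<close> minus \<open>T k\<close>, and the sum
      telescopes.\<close>
    define T where "T k = coeffp (A j * W (k(j := Suc (k j)))) (E k)" for k
    have W: "W (k(j := Suc (k j))) = - l j * W k" for k
    proof -
      have "(\<Prod>i\<in>UNIV - {j}. (- l i) ^ (k(j := Suc (k j))) i) = (\<Prod>i\<in>UNIV - {j}. (- l i) ^ k i)"
        by (rule prod.cong) auto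
      then show ?thesis
        unfolding W_def by (simp add: prod.remove[of UNIV j])
    qed
    have 1: "coeffp (A j * W k * variable j ^ M) (E k) = (if k j = 0 then 0 else T (k(j := k j - 1)))" for k
    proof (cases "k j")
      case 0
      then show ?thesis using \<open>M \<ge> 1\<close> by (simp add: lookup_mult_variable_power E_def)
    next
      case (Suc s)
      have "E k - Poly_Mapping.single j M = E (k(j := s))"
        by (rule poly_mapping_eqI) (auto simp: E_def lookup_minus lookup_single when_def Suc)
      moreover have "k(j := s, j := Suc s) = k" using Suc by auto
      ultimately show ?thesis
        using Suc by (simp add: lookup_mult_variable_power T_def) (simp add: E_def Suc)
    qed
    have "coeffp (A j * (variable j ^ M + l j) * W k) (E k)
        = (if k j = 0 then 0 else T (k(j := k j - 1))) - T k" for k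
    proof -
      have "A j * (variable j ^ M + l j) * W k = A j * W k * variable j ^ M - A j * W (k(j := Suc (k j)))"
        unfolding W by (simp add: algebra_simps)
      then show ?thesis by (simp only: lookup_minus 1) (simp only: T_def)
    qed
    then have "(\<Sum>k\<in>Box. coeffp (A j * (variable j ^ M + l j) * W k) (E k))
        = (\<Sum>k\<in>Box. if k j = 0 then 0 else T (k(j := k j - 1))) - (\<Sum>k\<in>Box. T k)"
      by (simp add: sum_subtractf)
    also have "(\<Sum>k\<in>Box. if k j = 0 then 0 else T (k(j := k j - 1)))
        = (\<Sum>k | k \<in> Box \<and> k j \<noteq> 0. T (k(j := k j - 1)))"
      by (rule sum.mono_neutral_cong_right) (auto simp: finBox)
    also have "\<dots> = (\<Sum>k | k \<in> Box \<and> k j < K. T k)"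
    proof (rule sum.reindex_bij_witness[where i = "\<lambda>k. k(j := Suc (k j))" and j = "\<lambda>k. k(j := k j - 1)"])
      fix k assume k: "k \<in> {k. k \<in> Box \<and> k j \<noteq> 0}"
      then show "k(j := k j - 1, j := Suc ((k(j := k j - 1)) j)) = k" by (simp add: fun_eq_iff)
      have "k j \<le> K" "k j \<noteq> 0" using k Box by auto
      then have "k j - 1 < K" by linarith
      then show "k(j := k j - 1) \<in> {k. k \<in> Box \<and> k j < K}"
        using k by (auto simp: Box)
    next
      fix k assume k: "k \<in> {k. k \<in> Box \<and> k j < K}"
      then show "k(j := Suc (k j), j := (k(j := Suc (k j))) j - 1) = k" by simp
      show "k(j := Suc (k j)) \<in> {k. k \<in> Box \<and> k j \<noteq> 0}"
        using k by (auto simp: Box)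
    qed simp
    \<comment> \<open>On the face \<open>k j = K\<close> the polynomial in \<open>T k\<close> has
      degree at most \<open>d j + (sum k UNIV + 1) * (M - 1)\<close>, which is below the degree of
      \<open>E k\<close> because \<open>K \<ge> d j + M\<close>.\<close>
    also have "(\<Sum>k\<in>Box. T k) = (\<Sum>k | k \<in> Box \<and> k j < K. T k)"
    proof (rule sum.mono_neutral_right[OF finBox]; safe)
      fix k assume "k \<in> Box" and "\<not> T k = 0"
      show "k j < K"
      proof (rule ccontr)
        assume "\<not> k j < K"
        then have kj: "k j = K" using \<open>k \<in> Box\<close> Box by (simp add: order_antisym)
        have s: "K \<le> sum k UNIV"
          using member_le_sum[of j UNIV k] by (simp add: kj)
        have s': "sum (k(j := Suc (k j))) UNIV = Suc (sum k UNIV)"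
          by (simp add: sum.remove[of UNIV j] cong: if_cong)
        have "d j \<le> (\<Sum>j\<in>UNIV. d j)" by (rule member_le_sum) auto
        then have "d j + M \<le> K" by (simp add: K_def)
        then have "d j + sum (k(j := Suc (k j))) UNIV * (M - 1) < M * sum k UNIV + CARD('n) * (M - 1)"
          using s \<open>M \<ge> 1\<close> unfolding s' M by simp
        from van[OF d this] have "T k = 0" by (simp add: T_def)
        with \<open>T k \<noteq> 0\<close> show False by simp
      qed
    qed
    finally show ?thesis by simp
  qed
  then have "(\<Sum>k\<in>Box. coeffp (h * W k) (E k)) = 0"
    by (simp add: h sum_distrib_right lookup_sum sum.swap[of _ UNIV])
  \<comment> \<open>The degree of \<open>E k\<close> exceeds the degree bound of
    \<open>h * W k\<close> by \<open>sum k UNIV\<close>.\<close>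
  also have "(\<Sum>k\<in>Box. coeffp (h * W k) (E k)) = (\<Sum>k\<in>{\<lambda>_. 0}. coeffp (h * W k) (E k))"
  proof (rule sum.mono_neutral_right[OF finBox]; (intro ballI)?)
    show "{\<lambda>_. 0} \<subseteq> Box" by (simp add: Box)
    fix k assume "k \<in> Box - {\<lambda>_. 0}"
    then obtain j where "k j \<noteq> 0" by auto
    then have "sum k UNIV > 0" by (auto simp: sum_eq_0_iff[of UNIV k, simplified] intro!: gr0I)
    then show "coeffp (h * W k) (E k) = 0"
      by (intro van[OF deg]) (simp add: M)
  qed
  finally show ?thesis by (simp add: W_def E_def)
qed

text \<open>Modulo the ideal, multiplying \<open>p\<close> by \<open>g\<close> amounts to
  multiplying it by the number g(a), since g - g(a) is a combination of the q_j - a_j.\<close>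

lemma ideal_span_variables:
  assumes "\<And>j. (variable j - Const (a $ j)) * p \<in> ideal.span S"
  shows "(g - Const (eval_poly g a)) * p \<in> ideal.span S"
proof -
  obtain d where "deg_le d g" using ex_deg_le by blast
  then obtain D where D: "g - Const (eval_poly g a) = (\<Sum>j\<in>UNIV. (variable j - Const (a $ j)) * D j)"
    using ex_difference_quotients[of d g a] by blast
  have "(\<Sum>j\<in>UNIV. D j * ((variable j - Const (a $ j)) * p)) \<in> ideal.span S"
    by (intro ideal.span_sum ideal.span_scale assms)
  then show ?thesis
    unfolding D sum_distrib_right by (simp only: mult_ac)
qed

text \<open>One preimage is chosen for each generator used, so that the combination is indexed by
  elements of \<open>Z\<close>, although \<open>f\<close> need not be injective.\<close>

lemma ideal_span_image_explicit:
  fixes f :: "'b \<Rightarrow> 'a::comm_ring_1"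
  assumes "y \<in> ideal.span (f ` Z)"
  obtains S r where "finite S" "S \<subseteq> Z" "y = (\<Sum>a\<in>S. r a * f a)"
proof -
  obtain t r where t: "finite t" "t \<subseteq> f ` Z" "y = (\<Sum>v\<in>t. r v * v)"
    using assms unfolding ideal.span_explicit by blast
  obtain S where S: "S \<subseteq> Z" "inj_on f S" "t = f ` S"
    using t(2) unfolding subset_image_inj by blast
  show thesis
  proof (rule that)
    show "finite S" using t(1) S by (simp add: finite_image_iff)
    show "y = (\<Sum>a\<in>S. r (f a) * f a)"
      unfolding t(3) S(3) by (simp add: sum.reindex[OF S(2)])
  qed (rule S)
qed

text \<open>\<open>top\<close> excludes common zeros at infinity and \<open>nondeg\<close> multiple
  zeros, so each summand is the local residue of \<open>g\<close> at a zero. Finiteness of the zero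
  set comes out of the same argument.\<close>

theorem euler_jacobi:
  fixes F :: "'n::finite \<Rightarrow> 'n cpoly"
  assumes deg: "\<And>i. deg_le m (F i)"
    and top: "\<And>x. (\<And>i. eval_poly (hpart m (F i)) x = 0) \<Longrightarrow> x = 0"
    and nondeg: "\<And>a. (\<And>i. eval_poly (F i) a = 0) \<Longrightarrow> det (\<chi> i j. eval_poly (partial j (F i)) a) \<noteq> 0"
    and g: "deg_le d g" and d: "d < CARD('n) * (m - 1)"
  shows "finite {a. \<forall>i. eval_poly (F i) a = 0}" (is "finite ?Z")
    and "(\<Sum>a | \<forall>i. eval_poly (F i) a = 0.
      eval_poly g a / det (\<chi> i j. eval_poly (partial j (F i)) a)) = 0"
proof -
  have m: "m \<ge> 2" using d by (cases "m - 1") auto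
  obtain M A where M: "M \<ge> m" and A: "\<And>j i. deg_le (M - m) (A j i)"
    and AH: "\<And>j. variable j ^ M = (\<Sum>i\<in>UNIV. A j i * hpart m (F i))"
    using ex_variable_powers_combination[where m = m and H = "\<lambda>i. hpart m (F i)"] top
    by (auto simp: hpart_hpart)
  define G where "G j = (\<Sum>i\<in>UNIV. A j i * F i)" for j
  define l where "l j = (\<Sum>i\<in>UNIV. A j i * (F i - hpart m (F i)))" for j
  have Gl: "G j = variable j ^ M + l j" for j
    by (simp add: G_def l_def AH right_diff_distrib sum_subtractf)
  have degl: "deg_le (M - 1) (l j)" for j
  proof -
    have "deg_le ((M - m) + (m - 1)) (l j)"
      unfolding l_def using m by (intro deg_le_sum deg_le_mult A deg_le_diff_hpart deg) simp
    then show ?thesis using M m by simp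
  qed
  define AM where "AM = (\<chi> j i. A j i)"
  define I where "I = ideal.span (range F)"
  define J where "J a = det (\<chi> i j. eval_poly (partial j (F i)) a)" for a

  define D where "D a i = (SOME D. (\<forall>j. deg_le (m - 1) (D j)) \<and>
     F i - Const (eval_poly (F i) a) = (\<Sum>j\<in>UNIV. (variable j - Const (a $ j)) * D j))" for a i
  have "(\<forall>j. deg_le (m - 1) (D a i j)) \<and>
     F i - Const (eval_poly (F i) a) = (\<Sum>j\<in>UNIV. (variable j - Const (a $ j)) * D a i j)" for a i
    unfolding D_def by (rule someI_ex[OF ex_difference_quotients[OF deg]])
  then have degD: "deg_le (m - 1) (D a i j)"
    and D: "F i - Const (eval_poly (F i) a) = (\<Sum>j\<in>UNIV. (variable j - Const (a $ j)) * D a i j)"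
    for a i j by blast+
  define DM where "DM a = (\<chi> i j. D a i j)" for a
  have DM: "DM a *v (\<chi> j. variable j - Const (a $ j)) = (\<chi> i. F i)" if "a \<in> ?Z" for a
  proof -
    have "(\<Sum>j\<in>UNIV. D a i j * (variable j - Const (a $ j))) = F i - Const (eval_poly (F i) a)" for i
      unfolding D by (simp only: mult.commute)
    then show ?thesis
      using that by (simp add: DM_def vec_eq_iff matrix_vector_mult_def)
  qed
  \<comment> \<open>The product rule, evaluated at \<open>a\<close>, annihilates every term that
    keeps a factor q_j - a_j.\<close>
  have evD: "eval_poly (D a i l) a = eval_poly (partial l (F i)) a" for a i l
  proof -
    have "partial l (F i) = partial l (F i - Const (eval_poly (F i) a))"
      by (simp add: partial_diff)
    also have "\<dots> = (\<Sum>j\<in>UNIV. (if l = j then 1 else 0) * D a i j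
        + (variable j - Const (a $ j)) * partial l (D a i j))"
      by (simp only: D partial_sum partial_mult partial_diff partial_variable partial_Const diff_zero)
    finally show ?thesis
      by (simp add: eval_poly_simps if_distrib[of "\<lambda>x. x * _"] if_distrib[of "\<lambda>x. eval_poly x _"] cong: if_cong)
  qed
  have evdet: "eval_poly (det (DM a)) a = J a" for a
    by (simp add: eval_poly_det DM_def J_def evD)
  have detI: "(variable k - Const (a $ k)) * det (DM a) \<in> I" if "a \<in> ?Z" for a k
  proof -
    obtain c where "(\<chi> j. variable j - Const (a $ j)) $ k * det (DM a)
        = (\<Sum>j\<in>UNIV. c j * (DM a *v (\<chi> j. variable j - Const (a $ j))) $ j)"
      using ex_cramer_comm_ring by blast
    then show ?thesis
      unfolding I_def ideal_span_range DM[OF that] by auto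
  qed
  have IZ: "eval_poly p b = 0" if "p \<in> I" "b \<in> ?Z" for p b
    using that unfolding I_def ideal_span_range by (auto simp: eval_poly_simps)
  have detI': "(p - Const (eval_poly p a)) * det (DM a) \<in> I" if "a \<in> ?Z" for a p
    using detI[OF that] unfolding I_def by (rule ideal_span_variables)
  \<comment> \<open>The product of \<open>det (DM a)\<close> with any q_k - a_k vanishes at all
    zeros; choose a coordinate in which \<open>a\<close> and \<open>b\<close> differ.\<close>
  have evdet0: "eval_poly (det (DM a)) b = 0" if "a \<in> ?Z" "b \<in> ?Z" "a \<noteq> b" for a b
  proof -
    obtain k where k: "a $ k \<noteq> b $ k" using \<open>a \<noteq> b\<close> by (auto simp: vec_eq_iff)
    from IZ[OF detI[OF that(1), of k] that(2)] k show ?thesis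
      by (simp add: eval_poly_simps)
  qed

  \<comment> \<open>A common zero of these polynomials would be a zero \<open>b\<close> of the
    \<open>F i\<close> with \<open>J b = 0\<close>.\<close>
  have "1 \<in> ideal.span (range F \<union> (\<lambda>a. det (DM a)) ` ?Z)"
  proof (rule ccontr)
    assume "\<not> ?thesis"
    then obtain b where b: "\<forall>f\<in>range F \<union> (\<lambda>a. det (DM a)) ` ?Z. eval_poly f b = 0"
      using weak_nullstellensatz by blast
    then have "b \<in> ?Z" by auto
    with b have "J b = 0" by (auto simp flip: evdet)
    with nondeg \<open>b \<in> ?Z\<close> show False unfolding J_def by auto
  qed
  then obtain x y where x: "x \<in> I" and y: "y \<in> ideal.span ((\<lambda>a. det (DM a)) ` ?Z)" and xy: "1 = x + y"
    unfolding ideal.span_Un I_def by blast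
  obtain S r where S: "finite S" "S \<subseteq> ?Z" and yS: "y = (\<Sum>a\<in>S. r a * det (DM a))"
    using ideal_span_image_explicit[OF y] by blast
  have one: "(\<Sum>a\<in>S. eval_poly (r a) b * eval_poly (det (DM a)) b) = 1" if "b \<in> ?Z" for b
  proof -
    have "eval_poly (x + y) b = 1" unfolding xy[symmetric] by simp
    then show ?thesis using IZ[OF x that] by (simp add: yS eval_poly_simps)
  qed
  \<comment> \<open>At a zero outside the finite set \<open>S\<close> every summand in the
    representation of 1 would vanish. So \<open>S\<close> contains all zeros.\<close>
  have "b \<in> S" if "b \<in> ?Z" for b
  proof (rule ccontr)
    assume "b \<notin> S"
    have "eval_poly (det (DM a)) b = 0" if "a \<in> S" for a
      using that S(2) \<open>b \<in> ?Z\<close> \<open>b \<notin> S\<close> by (intro evdet0) auto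
    then have "(\<Sum>a\<in>S. eval_poly (r a) b * eval_poly (det (DM a)) b) = 0"
      by simp
    with one[OF that] show False by simp
  qed
  with S have SZ: "S = ?Z" by blast
  show fin: "finite ?Z" using S(1) unfolding SZ .
  have rJ: "eval_poly (r b) b = 1 / J b" if "b \<in> ?Z" for b
  proof -
    have "(\<Sum>a\<in>S. eval_poly (r a) b * eval_poly (det (DM a)) b)
        = (\<Sum>a\<in>S. if a = b then eval_poly (r b) b * J b else 0)"
    proof (intro sum.cong refl)
      fix a assume "a \<in> S"
      then show "eval_poly (r a) b * eval_poly (det (DM a)) b = (if a = b then eval_poly (r b) b * J b else 0)"
        using evdet0[of a b] that S(2) by (cases "a = b") (auto simp: evdet)
    qed
    with one[OF that] that S have "eval_poly (r b) b * J b = 1"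
      by (simp add: SZ)
    then show ?thesis by (metis eq_divide_imp mult_zero_right zero_neq_one)
  qed
  define c where "c a = eval_poly g a / J a" for a
  \<comment> \<open>The representation of 1 is multiplied by \<open>g\<close>, and each coefficient
    \<open>g * r a\<close> is replaced by its value at \<open>a\<close>, which is
    \<open>c a\<close>.\<close>
  have gI: "g - (\<Sum>a\<in>?Z. Const (c a) * det (DM a)) \<in> I"
  proof -
    have "g * x + (\<Sum>a\<in>?Z. (g * r a - Const (eval_poly (g * r a) a)) * det (DM a)) \<in> I"
      unfolding I_def
      by (intro ideal.span_add ideal.span_scale[OF x[unfolded I_def]] ideal.span_sum detI'[unfolded I_def])
    also have "(\<Sum>a\<in>?Z. (g * r a - Const (eval_poly (g * r a) a)) * det (DM a))
        = g * y - (\<Sum>a\<in>?Z. Const (c a) * det (DM a))"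
      unfolding yS SZ sum_distrib_left left_diff_distrib sum_subtractf
      by (intro arg_cong2[of _ _ _ _ "(-)"] sum.cong) (simp_all add: mult.assoc eval_poly_mult rJ c_def)
    also have "g * x + (g * y - (\<Sum>a\<in>?Z. Const (c a) * det (DM a)))
        = g * (x + y) - (\<Sum>a\<in>?Z. Const (c a) * det (DM a))"
      by (simp add: algebra_simps)
    finally show ?thesis unfolding xy[symmetric] by simp
  qed
  have detG: "det AM * p \<in> ideal.span (range G)" if p: "p \<in> I" for p
  proof -
    obtain C where C: "p = (\<Sum>i\<in>UNIV. C i * F i)"
      using p unfolding I_def ideal_span_range by blast
    have "det AM * F i \<in> ideal.span (range G)" for i
    proof -
      obtain c where "(\<chi> i. F i) $ i * det AM = (\<Sum>j\<in>UNIV. c j * (AM *v (\<chi> i. F i)) $ j)"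
        using ex_cramer_comm_ring by blast
      moreover have "(AM *v (\<chi> i. F i)) $ j = G j" for j
        by (simp add: AM_def G_def matrix_vector_mult_def)
      ultimately show ?thesis
        unfolding ideal_span_range by (auto simp: mult.commute)
    qed
    then have "(\<Sum>i\<in>UNIV. C i * (det AM * F i)) \<in> ideal.span (range G)"
      by (meson ideal.span_sum ideal.span_scale)
    then show ?thesis unfolding C sum_distrib_left by (simp only: mult_ac)
  qed
  define h where "h = det AM * (g - (\<Sum>a\<in>?Z. Const (c a) * det (DM a)))"
  have h: "h = det AM * g - (\<Sum>a\<in>?Z. Const (c a) * det (AM ** DM a))"
    unfolding h_def right_diff_distrib sum_distrib_left det_mul by (simp only: mult_ac)
  have degAD: "deg_le (M - 1) ((AM ** DM a) $ i $ j)" for a i j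
  proof -
    have "deg_le ((M - m) + (m - 1)) ((AM ** DM a) $ i $ j)"
      unfolding matrix_matrix_mult_def AM_def DM_def vec_lambda_beta
      by (intro deg_le_sum deg_le_mult A degD)
    then show ?thesis using M m by simp
  qed
  have "CARD('n) * (M - 1) = CARD('n) * (M - m) + CARD('n) * (m - 1)"
    using M m by (simp flip: distrib_left)
  \<comment> \<open>By the bound on \<open>d\<close>, the product \<open>det AM * g\<close> has too
    small a degree to contain the monomial that is compared.\<close>
  then have lt: "CARD('n) * (M - m) + d < CARD('n) * (M - 1)" using d by simp
  have degAg: "deg_le (CARD('n) * (M - m) + d) (det AM * g)"
    by (intro deg_le_mult deg_le_det g) (simp add: AM_def A)
  have degh: "deg_le (CARD('n) * (M - 1)) h"
    unfolding h
  proof (intro deg_le_diff deg_le_sum)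
    show "deg_le (CARD('n) * (M - 1)) (det AM * g)"
      using degAg lt by (auto intro: deg_le_mono)
    show "deg_le (CARD('n) * (M - 1)) (Const (c a) * det (AM ** DM a))" for a
      using deg_le_mult[OF deg_le_Const[of 0] deg_le_det[OF degAD]] by simp
  qed
  obtain B where B: "h = (\<Sum>j\<in>UNIV. B j * (variable j ^ M + l j))"
    using detG[OF gI] unfolding h_def[symmetric] ideal_span_range Gl by blast
  have "coeffp h (mon (\<lambda>_. M - 1)) = 0"
    using coeff_eq_0_of_combination[OF _ degl B degh] M m by simp
  moreover have "coeffp (det AM * g) (mon (\<lambda>_. M - 1)) = 0"
    by (rule deg_leD[OF degAg]) (use lt in \<open>simp add: mdeg_mon\<close>)
  \<comment> \<open>Multiplying F = D_a (q - a) by \<open>AM\<close> and taking top parts gives a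
    matrix that sends the vector of variables to that of their \<open>M\<close>-th powers, so its
    determinant has coefficient 1 here.\<close>
  moreover have "coeffp (Const (c a) * det (AM ** DM a)) (mon (\<lambda>_. M - 1)) = c a" if "a \<in> ?Z" for a
  proof -
    let ?B = "\<chi> i j. hpart (M - 1) ((AM ** DM a) $ i $ j)"
    have "(\<Sum>j\<in>UNIV. ?B $ i $ j * variable j) = variable i ^ M" for i
    proof -
      have "(AM ** DM a) *v (\<chi> j. variable j - Const (a $ j)) = AM *v (\<chi> i. F i)"
        by (simp only: DM[OF that] flip: matrix_vector_mul_assoc)
      then have "((AM ** DM a) *v (\<chi> j. variable j - Const (a $ j))) $ i = G i"
        by (simp add: AM_def G_def matrix_vector_mult_def)
      then have "(\<Sum>j\<in>UNIV. (AM ** DM a) $ i $ j * (variable j - Const (a $ j))) = variable i ^ M + l i"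
        by (simp add: matrix_vector_mult_def Gl)
      then have "(\<Sum>j\<in>UNIV. hpart ((M - 1) + 1) ((AM ** DM a) $ i $ j * (variable j - Const (a $ j))))
          = hpart M (variable i ^ M + l i)"
        using M m by (simp flip: hpart_sum)
      moreover have "hpart ((M - 1) + 1) ((AM ** DM a) $ i $ j * (variable j - Const (a $ j)))
          = ?B $ i $ j * variable j" for j
      proof -
        have "hpart 1 (variable j - Const (a $ j)) = variable j"
          by (simp add: variable_def hpart_diff hpart_single)
        then show ?thesis
          by (subst hpart_mult[OF degAD]) (simp_all add: deg_le_diff deg_le_variable)
      qed
      moreover have "hpart M (variable i ^ M + l i) = variable i ^ M"
        using hpart_eq_0[OF degl, of M] M m
        by (simp add: hpart_add variable_power hpart_single)
      ultimately show ?thesis by simp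
    qed
    then have "coeffp (det ?B) (mon (\<lambda>_. M - 1)) = 1"
      using M m by (intro coeff_det_of_variable_powers) simp_all
    then have "coeffp (hpart (CARD('n) * (M - 1)) (det (AM ** DM a))) (mon (\<lambda>_. M - 1)) = 1"
      unfolding hpart_det[OF degAD] .
    then have "coeffp (det (AM ** DM a)) (mon (\<lambda>_. M - 1)) = 1"
      by (simp add: lookup_hpart mdeg_mon)
    moreover have "coeffp (Const b * p) e = b * coeffp p e" for b e and p :: "'n cpoly"
      by (simp add: Poly_Mapping.map.rep_eq when_def flip: mult_map_scale_conv_mult)
    ultimately show ?thesis by simp
  qed
  ultimately show "(\<Sum>a\<in>?Z. eval_poly g a / det (\<chi> i j. eval_poly (partial j (F i)) a)) = 0"
    by (simp add: h lookup_minus lookup_sum c_def J_def)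
qed

section \<open>Eigenvalues and elementary symmetric polynomials\<close>

subsection \<open>The characteristic polynomial\<close>

text \<open>A point that is moved has an image that is moved too. Hence the Leibniz products of
  non-identity permutations in the characteristic polynomial have degree at most n - 2.\<close>

lemma card_fixpoints_permutation:
  fixes \<sigma> :: "'n::finite \<Rightarrow> 'n"
  assumes "\<sigma> permutes UNIV" "\<sigma> \<noteq> id"
  shows "card {i. \<sigma> i = i} + 2 \<le> CARD('n)"
proof -
  obtain i where i: "\<sigma> i \<noteq> i" using assms(2) by (auto simp: fun_eq_iff)
  have inj: "inj \<sigma>" using assms(1) by (rule permutes_inj)
  then have "\<sigma> (\<sigma> i) \<noteq> \<sigma> i" using i by (simp add: inj_eq)
  then have "{i. \<sigma> i = i} \<subseteq> UNIV - {i, \<sigma> i}" using i by auto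
  then have "card {i. \<sigma> i = i} \<le> card (UNIV - {i, \<sigma> i})" by (intro card_mono) auto
  moreover have "card {i, \<sigma> i} \<le> CARD('n)" by (rule card_mono) auto
  ultimately show ?thesis using i by (simp add: card_Diff_subset)
qed

lemma coeff_charpoly:
  fixes A :: "complex^'n::finite^'n"
  assumes "e + 1 \<ge> CARD('n)"
  shows "coeff (charpoly A) e = coeff (\<Prod>i\<in>UNIV. [:- A $ i $ i, 1:]) e"
proof -
  define X where "X = mat [:0, 1:] - map_matrix (\<lambda>c. [:c:]) A"
  have X: "X $ i $ j = (if i = j then [:- A $ i $ j, 1:] else [:- A $ i $ j:])" for i j
    by (simp add: X_def mat_def map_matrix_def)
  have deg: "degree (\<Prod>i\<in>UNIV. X $ i $ \<sigma> i) + 2 \<le> CARD('n)" if "\<sigma> permutes UNIV" "\<sigma> \<noteq> id" for \<sigma>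
  proof -
    have "degree (\<Prod>i\<in>UNIV. X $ i $ \<sigma> i) \<le> (\<Sum>i\<in>UNIV. degree (X $ i $ \<sigma> i))"
      by (rule degree_prod_sum_le[unfolded comp_def]) simp
    also have "\<dots> \<le> (\<Sum>i\<in>UNIV. if \<sigma> i = i then 1 else 0)"
      by (rule sum_mono) (auto simp: X)
    also have "\<dots> = card {i. \<sigma> i = i}"
      by (simp add: sum.If_cases)
    finally show ?thesis using card_fixpoints_permutation[OF that] by simp
  qed
  have "coeff (charpoly A) e
      = (\<Sum>\<sigma> | \<sigma> permutes UNIV. coeff (of_int (sign \<sigma>) * (\<Prod>i\<in>UNIV. X $ i $ \<sigma> i)) e)"
    by (simp only: charpoly_def det_def coeff_sum X_def)
  also have "\<dots> = (\<Sum>\<sigma>\<in>{id}. coeff (of_int (sign \<sigma>) * (\<Prod>i\<in>UNIV. X $ i $ \<sigma> i)) e)"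
  proof (rule sum.mono_neutral_right)
    show "\<forall>\<sigma>\<in>{\<sigma>. \<sigma> permutes UNIV} - {id}. coeff (of_int (sign \<sigma>) * (\<Prod>i\<in>UNIV. X $ i $ \<sigma> i)) e = 0"
    proof
      fix \<sigma> assume "\<sigma> \<in> {\<sigma>. \<sigma> permutes (UNIV :: 'n set)} - {id}"
      then have "coeff (\<Prod>i\<in>UNIV. X $ i $ \<sigma> i) e = 0"
        using deg[of \<sigma>] assms by (intro coeff_eq_0) auto
      then show "coeff (of_int (sign \<sigma>) * (\<Prod>i\<in>UNIV. X $ i $ \<sigma> i)) e = 0"
        by (cases "evenperm \<sigma>") (simp_all add: sign_def)
    qed
  qed (auto simp: permutes_id)
  also have "\<dots> = coeff (\<Prod>i\<in>UNIV. [:- A $ i $ i, 1:]) e"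
    by (simp add: X)
  finally show ?thesis .
qed

lemma coeff_prod_linear_factors:
  fixes M :: "complex multiset"
  shows "degree (\<Prod>x\<in>#M. [:- x, 1:]) = size M"
    and "lead_coeff (\<Prod>x\<in>#M. [:- x, 1:]) = 1"
    and "M \<noteq> {#} \<Longrightarrow> coeff (\<Prod>x\<in>#M. [:- x, 1:]) (size M - 1) = - \<Sum>\<^sub># M"
proof -
  have nz: "(\<Prod>x\<in>#M. [:- x, 1:]) \<noteq> 0" for M :: "complex multiset"
    by (auto simp: prod_mset_zero_iff)
  have 1: "degree (\<Prod>x\<in>#M. [:- x, 1:]) = size M" for M :: "complex multiset"
  proof (induction M)
    case (add x M)
    then show ?case using nz[of M] by (simp add: degree_mult_eq del: mult_pCons_left)
  qed simp
  then show "degree (\<Prod>x\<in>#M. [:- x, 1:]) = size M" .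
  have 2: "lead_coeff (\<Prod>x\<in>#M. [:- x, 1:]) = 1" for M :: "complex multiset"
  proof (induction M)
    case (add x M)
    then show ?case by (simp add: lead_coeff_mult del: mult_pCons_left)
  qed simp
  then show "lead_coeff (\<Prod>x\<in>#M. [:- x, 1:]) = 1" .
  show "coeff (\<Prod>x\<in>#M. [:- x, 1:]) (size M - 1) = - \<Sum>\<^sub># M" if "M \<noteq> {#}"
    using that
  proof (induction M)
    case (add x M)
    have "coeff (\<Prod>x\<in>#M. [:- x, 1:]) (size M) = 1" using 1[of M] 2[of M] by simp
    then show ?case
      using add by (cases "M = {#}"; cases "size M") auto
  qed simp
qed

lemma charpoly_monic:
  fixes A :: "complex^'n::finite^'n"
  shows "degree (charpoly A) = CARD('n)" and "lead_coeff (charpoly A) = 1"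
    and "coeff (charpoly A) (CARD('n) - 1) = - trace A"
proof -
  define M where "M = image_mset (\<lambda>i. A $ i $ i) (mset_set UNIV)"
  have size: "size M = CARD('n)" by (simp add: M_def)
  have "M \<noteq> {#}" unfolding size_eq_0_iff_empty[symmetric] size by simp
  have P: "(\<Prod>i\<in>UNIV. [:- A $ i $ i, 1:]) = (\<Prod>x\<in>#M. [:- x, 1:])"
    by (simp add: M_def prod_unfold_prod_mset image_mset.compositionality comp_def)
  have "coeff (charpoly A) e = 0" if "e > CARD('n)" for e
    using that coeff_charpoly[of e A] coeff_prod_linear_factors(1)[of M]
    by (simp add: P coeff_eq_0 size)
  then have "degree (charpoly A) \<le> CARD('n)" by (intro degree_le) auto
  moreover have 1: "coeff (charpoly A) (CARD('n)) = 1"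
    using coeff_charpoly[of "CARD('n)" A] coeff_prod_linear_factors(1,2)[of M]
    by (simp add: P size)
  ultimately show "degree (charpoly A) = CARD('n)"
    by (simp add: le_degree order_antisym)
  with 1 show "lead_coeff (charpoly A) = 1" by simp
  show "coeff (charpoly A) (CARD('n) - 1) = - trace A"
    using coeff_charpoly[of "CARD('n) - 1" A] coeff_prod_linear_factors(3)[OF \<open>M \<noteq> {#}\<close>]
    by (simp add: P size trace_def) (simp add: M_def sum_unfold_sum_mset)
qed

lemma charpoly_eq_prod_eigenvalues:
  "charpoly A = (\<Prod>x\<in>#eigenvalues A. [:- x, 1:])"
  using complex_poly_decompose_multiset[of "charpoly A"]
  by (simp add: charpoly_monic(2) eigenvalues_def)

lemma size_eigenvalues:
  fixes A :: "complex^'n::finite^'n"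
  shows "size (eigenvalues A) = CARD('n)"
  by (simp add: eigenvalues_def size_proots_complex charpoly_monic)

lemma sum_eigenvalues: "\<Sum>\<^sub># (eigenvalues A) = trace A" for A :: "complex^'n::finite^'n"
proof -
  have "eigenvalues A \<noteq> {#}"
    unfolding size_eq_0_iff_empty[symmetric] size_eigenvalues by simp
  from coeff_prod_linear_factors(3)[OF this] charpoly_monic(3)[of A] show ?thesis
    by (simp add: size_eigenvalues flip: charpoly_eq_prod_eigenvalues)
qed

section \<open>Determinants in terms of eigenvalues\<close>

lemma poly_charpoly: "poly (charpoly A) z = det (\<chi> i j. (if i = j then z else 0) - A $ i $ j)"
proof -
  have "poly (of_int s) z = of_int s" for s by (simp add: of_int_poly)
  moreover have "poly ((mat [:0, 1:] - map_matrix (\<lambda>c. [:c:]) A) $ i $ j) z = (if i = j then z else 0) - A $ i $ j"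
    for i j by (simp add: mat_def map_matrix_def)
  ultimately show ?thesis
    by (simp only: charpoly_def det_def poly_sum poly_mult poly_prod vec_lambda_beta)
qed

lemma eigenvalueI:
  assumes "A *v x = c *s x" "x \<noteq> 0"
  shows "c \<in># eigenvalues A"
proof -
  let ?B = "\<chi> i j. (if i = j then c else 0) - A $ i $ j"
  have "?B *v x = 0"
    using assms(1)
    by (simp add: vec_eq_iff matrix_vector_mult_def left_diff_distrib sum_subtractf
        if_distrib[of "\<lambda>y. y * _"] cong: if_cong)
  then have "\<not> (\<exists>B'. B' ** ?B = mat 1)"
    unfolding matrix_left_invertible_ker using assms(2) by blast
  then have "det ?B = 0"
    unfolding invertible_left_inverse[symmetric] invertible_det_nz by (rule notnotD)
  moreover have "charpoly A \<noteq> 0" using charpoly_monic(2)[of A] by auto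
  ultimately show ?thesis by (simp add: eigenvalues_def poly_charpoly)
qed

lemma det_identity_plus:
  fixes A :: "complex^'n::finite^'n"
  shows "det (\<chi> i j. (if i = j then 1 else 0) + t * (A $ i $ j - (if i = j then 1 else 0)))
    = (\<Prod>x\<in>#eigenvalues A. 1 + t * (x - 1))"
proof (cases "t = 0")
  case True
  have "(\<chi> i j. if i = j then 1 else 0) = (mat 1 :: complex^'n^'n)" by (simp add: mat_def)
  with True show ?thesis by simp
next
  case False
  \<comment> \<open>Chosen so that 1 + t (A - 1) = - t (z - A).\<close>
  define z where "z = (t - 1) / t"
  have "(\<chi> i j. (if i = j then 1 else 0) + t * (A $ i $ j - (if i = j then 1 else 0)))
      = (\<chi> i. (- t) *s (\<chi> i j. (if i = j then z else 0) - A $ i $ j) $ i)"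
    using False by (simp add: vec_eq_iff z_def field_simps)
  then have "det (\<chi> i j. (if i = j then 1 else 0) + t * (A $ i $ j - (if i = j then 1 else 0)))
      = (- t) ^ CARD('n) * poly (charpoly A) z"
    by (simp only: det_rows_mul poly_charpoly) simp
  also have "\<dots> = (- t) ^ size (eigenvalues A) * (\<Prod>x\<in>#eigenvalues A. z - x)"
    unfolding charpoly_eq_prod_eigenvalues
    by (simp add: size_eigenvalues poly_prod_mset image_mset.compositionality comp_def)
  also have "\<dots> = (\<Prod>x\<in>#eigenvalues A. (- t) * (z - x))"
    unfolding prod_mset.distrib by simp
  also have "(\<lambda>x. (- t) * (z - x)) = (\<lambda>x. 1 + t * (x - 1))"
    using False by (auto simp: z_def field_simps)
  finally show ?thesis .
qed

lemma det_minus_identity: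
  fixes A :: "complex^'n::finite^'n"
  shows "det (\<chi> i j. A $ i $ j - (if i = j then 1 else 0)) = (\<Prod>x\<in>#eigenvalues A. x - 1)"
proof -
  have "(\<chi> i j. A $ i $ j - (if i = j then 1 else 0))
      = (\<chi> i. (- 1) *s (\<chi> i j. (if i = j then 1 else 0) - A $ i $ j) $ i)"
    by (simp add: vec_eq_iff)
  then have "det (\<chi> i j. A $ i $ j - (if i = j then 1 else 0)) = (- 1) ^ CARD('n) * poly (charpoly A) 1"
    by (simp only: det_rows_mul poly_charpoly) simp
  also have "\<dots> = (- 1) ^ size (eigenvalues A) * (\<Prod>x\<in>#eigenvalues A. 1 - x)"
    unfolding charpoly_eq_prod_eigenvalues
    by (simp add: size_eigenvalues poly_prod_mset image_mset.compositionality comp_def)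
  also have "\<dots> = (\<Prod>x\<in>#eigenvalues A. (- 1) * (1 - x))"
    unfolding prod_mset.distrib by simp
  finally show ?thesis by simp
qed

subsection \<open>Elementary symmetric polynomials\<close>

text \<open>The generating function of the elementary symmetric polynomials: the product is expanded
  over sets of positions, which are grouped by cardinality.\<close>

lemma prod_list_one_plus:
  "(\<Prod>y\<leftarrow>xs. 1 + t * y) = (\<Sum>r\<le>length xs. tau r xs * t ^ r)"
proof -
  have "(\<Prod>y\<leftarrow>xs. 1 + t * y) = (\<Prod>i<length xs. t * xs ! i + 1)"
    by (simp add: prod.list_conv_set_nth atLeast0LessThan add.commute)
  also have "\<dots> = (\<Sum>I\<in>Pow {..<length xs}. \<Prod>i\<in>I. t * xs ! i)"
    by (simp add: prod_add)
  also have "\<dots> = (\<Sum>r\<le>length xs. \<Sum>I | I \<in> Pow {..<length xs} \<and> card I = r. \<Prod>i\<in>I. t * xs ! i)"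
    by (rule sum.group[symmetric]) (auto intro: card_mono[of "{..<length xs}", simplified])
  also have "\<dots> = (\<Sum>r\<le>length xs. tau r xs * t ^ r)"
    unfolding tau_def sum_distrib_right
    by (intro sum.cong) (auto simp: prod.distrib mult.commute)
  finally show ?thesis .
qed

lemma tau_length: "tau (length xs) xs = prod_list xs"
proof -
  have "{I. I \<subseteq> {..<length xs} \<and> card I = length xs} = {{..<length xs}}"
    using card_subset_eq[of "{..<length xs}"] by auto
  then have "tau (length xs) xs = (\<Prod>i<length xs. xs ! i)" by (simp add: tau_def)
  also have "\<dots> = prod_list xs"
    by (simp add: prod.list_conv_set_nth atLeast0LessThan)
  finally show ?thesis .
qed

lemma tau_1: "tau 1 xs = sum_list xs"
proof -
  have "{I. I \<subseteq> {..<length xs} \<and> card I = 1} = (\<lambda>i. {i}) ` {..<length xs}"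
    by (auto simp: card_1_singleton_iff)
  then have "tau 1 xs = (\<Sum>i<length xs. xs ! i)"
    unfolding tau_def by (simp add: sum.reindex)
  then show ?thesis by (simp add: sum_list_sum_nth atLeast0LessThan)
qed

text \<open>Every row vanishes at \<open>l\<close> and annihilates \<open>w\<close>: two independent
  linear conditions. For a Jacobian matrix in the chart of \<open>l\<close>, a kernel vector tangent
  to the chart thus pushes the rank below n - 1.\<close>

lemma rank_le_of_kernel:
  fixes K :: "'a::field^'n::finite^'m::finite" and w :: "'a^'n"
  assumes col: "\<And>a. K $ a $ l = 0" and ker: "K *v w = 0" and w: "w $ l = 0" "w \<noteq> 0"
  shows "rank K + 2 \<le> CARD('n)"
proof -
  obtain j0 where j0: "w $ j0 \<noteq> 0" using w(2) by (auto simp: vec_eq_iff)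
  then have "j0 \<noteq> l" using w(1) by auto
  \<comment> \<open>For \<open>j\<close> other than \<open>l\<close> and \<open>j0\<close> these
    span the vectors satisfying both conditions: the entry at \<open>j0\<close> is determined by the
    others.\<close>
  define b where "b j = axis j 1 - (w $ j / w $ j0) *s axis j0 1" for j
  let ?B = "b ` (UNIV - {l, j0})"
  have "rows K \<subseteq> vec.span ?B"
  proof
    fix x assume "x \<in> rows K"
    then obtain a where x: "x = K $ a" by (auto simp: rows_def row_def vec_eq_iff)
    have "(\<Sum>j\<in>UNIV - {l, j0}. x $ j * w $ j) + (\<Sum>j\<in>{l, j0}. x $ j * w $ j) = (\<Sum>j\<in>UNIV. x $ j * w $ j)"
      by (rule sum.subset_diff[symmetric]) auto
    also have "\<dots> = 0"
      using ker by (simp add: vec_eq_iff matrix_vector_mult_def x)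
    finally have "(\<Sum>j\<in>UNIV - {l, j0}. x $ j * w $ j) = - (x $ j0 * w $ j0)"
      using \<open>j0 \<noteq> l\<close> w(1) by (simp add: eq_neg_iff_add_eq_0)
    then have s: "(\<Sum>j\<in>UNIV - {l, j0}. x $ j * (w $ j / w $ j0)) = - x $ j0"
      using j0 by (simp flip: sum_divide_distrib)
    have "x = (\<Sum>j\<in>UNIV - {l, j0}. x $ j *s b j)"
    proof (subst vec_eq_iff, rule allI)
      fix i
      have "(\<Sum>j\<in>UNIV - {l, j0}. x $ j *s b j) $ i
          = (\<Sum>j\<in>UNIV - {l, j0}. (if j = i then x $ i else 0))
            - (\<Sum>j\<in>UNIV - {l, j0}. x $ j * (w $ j / w $ j0)) * (if i = j0 then 1 else 0)"
        unfolding sum_distrib_right sum_subtractf[symmetric] sum_component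
        by (rule sum.cong) (auto simp: b_def axis_def)
      also have "\<dots> = (if i = l \<or> i = j0 then 0 else x $ i) + x $ j0 * (if i = j0 then 1 else 0)"
        unfolding s by simp
      also have "\<dots> = x $ i"
        using col[of a] \<open>j0 \<noteq> l\<close> x by auto
      finally show "x $ i = (\<Sum>j\<in>UNIV - {l, j0}. x $ j *s b j) $ i" ..
    qed
    also have "\<dots> \<in> vec.span ?B"
      by (intro vec.span_sum vec.span_scale vec.span_base) auto
    finally show "x \<in> vec.span ?B" .
  qed
  then have "rank K \<le> card ?B"
    unfolding row_rank_def_gen by (rule vec.dim_le_card) simp
  also have "\<dots> \<le> card (UNIV - {l, j0})" by (rule card_image_le) simp
  finally have "rank K \<le> CARD('n) - 2"
    using \<open>j0 \<noteq> l\<close> by (simp add: card_Diff_subset)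
  moreover have "card {l, j0} \<le> CARD('n)" by (rule card_mono) auto
  ultimately show ?thesis using \<open>j0 \<noteq> l\<close> by simp
qed

section \<open>Darboux points\<close>

subsection \<open>Simple Darboux points\<close>

lemma dehomogenise_add: "dehomogenise l (p + q) = dehomogenise l p + dehomogenise l q"
  unfolding dehomogenise_def
  by (rule setsum_keys_plus_distrib[where f = "\<lambda>m c. Poly_Mapping.single
        (m - Poly_Mapping.single l (Poly_Mapping.lookup m l)) c"])
    (simp_all add: single_add)

lemma dehomogenise_single: "dehomogenise l (Poly_Mapping.single m c)
    = Poly_Mapping.single (m - Poly_Mapping.single l (Poly_Mapping.lookup m l)) c"
  by (cases "c = 0") (simp_all add: dehomogenise_def)

text \<open>Setting q_l to 1 commutes with the other derivatives and keeps their values where q_l is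
  1, so the Jacobian matrix in a chart can be computed from the original polynomials.\<close>

lemma eval_partial_dehomogenise:
  fixes p :: "complex^'n::finite"
  assumes "p $ l = 1"
  shows "eval_poly (partial j (dehomogenise l f)) p = (if j = l then 0 else eval_poly (partial j f) p)"
proof (induction f rule: poly_mapping_induct_singles)
  case (single m c)
  show ?case
  proof (cases "j = l")
    case True
    then show ?thesis
      by (simp add: dehomogenise_single partial_single lookup_minus)
  next
    case False
    have "(\<Prod>i\<in>UNIV. p $ i ^ Poly_Mapping.lookup
          (m - Poly_Mapping.single l (Poly_Mapping.lookup m l) - Poly_Mapping.single j 1) i)
        = (\<Prod>i\<in>UNIV. p $ i ^ Poly_Mapping.lookup (m - Poly_Mapping.single j 1) i)"
    proof (rule prod.cong[OF refl])
      fix i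
      show "p $ i ^ Poly_Mapping.lookup
          (m - Poly_Mapping.single l (Poly_Mapping.lookup m l) - Poly_Mapping.single j 1) i
        = p $ i ^ Poly_Mapping.lookup (m - Poly_Mapping.single j 1) i"
        using assms by (cases "i = l") (simp_all add: lookup_minus lookup_single when_def)
    qed
    with False show ?thesis
      by (simp add: dehomogenise_single partial_single eval_poly_single lookup_minus
          lookup_single when_def)
  qed
qed (auto simp: dehomogenise_add partial_add eval_poly_add)

lemma gradient_scale:
  assumes "homogeneous k V"
  shows "gradient V (c *s x) = c ^ (k - 1) *s gradient V x"
  using eval_poly_scale[OF homogeneous_partial[OF assms], of _ c x]
  by (simp add: gradient_def vec_eq_iff)

lemma hessian_scale:
  assumes "homogeneous k V"
  shows "hessian V (c *s x) $ i $ j = c ^ (k - 2) * hessian V x $ i $ j"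
proof -
  have "k - 1 - 1 = k - 2" by simp
  then show ?thesis
    using eval_poly_scale[OF homogeneous_partial[OF homogeneous_partial[OF assms]], of j i c x]
    by (simp add: hessian_def)
qed

lemma hessian_mult_self:
  assumes "homogeneous k V"
  shows "hessian V x *v x = of_nat (k - 1) *s gradient V x"
  using euler_identity[OF homogeneous_partial[OF assms], of x]
  by (simp add: hessian_def gradient_def vec_eq_iff matrix_vector_mult_def mult.commute)

text \<open>Product rule for the derivative of R_ij at \<open>p\<close> in the direction
  \<open>w\<close>.\<close>

lemma eval_partial_darboux_eqs:
  "(\<Sum>c\<in>UNIV. eval_poly (partial c (darboux_eqs V (i, j))) p * w $ c)
    = w $ i * gradient V p $ j + p $ i * (hessian V p *v w) $ j
      - w $ j * gradient V p $ i - p $ j * (hessian V p *v w) $ i"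
proof -
  have "(\<Sum>c\<in>UNIV. eval_poly (partial c (variable i * partial j V)) p * w $ c)
      = w $ i * gradient V p $ j + p $ i * (hessian V p *v w) $ j" for i j
  proof -
    have "eval_poly (partial c (variable i * partial j V)) p * w $ c
        = (if c = i then w $ i * gradient V p $ j else 0) + p $ i * (hessian V p $ j $ c * w $ c)" for c
      by (simp add: partial_mult partial_variable eval_poly_add eval_poly_mult gradient_def hessian_def
          algebra_simps)
    then show ?thesis
      by (simp add: sum.distrib matrix_vector_mult_def sum_distrib_left)
  qed
  then show ?thesis
    by (simp add: darboux_eqs_def partial_diff eval_poly_diff left_diff_distrib sum_subtractf)
qed

text \<open>A nonzero \<open>v\<close> fixed by the Hessian, made tangent to the chart by
  subtracting a multiple of \<open>d\<close>, lies in the kernel of the Jacobian matrix of the R_ij.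
  The rank would then be at most n - 2.\<close>

lemma simple_point_imp_det_hessian:
  fixes V :: "'n::finite cpoly"
  assumes k: "k > 2" and hom: "homogeneous k V"
    and d: "gradient V d = d" "d \<noteq> 0" and simple: "simple_point (darboux_eqs V) d"
  shows "det (hessian V d - mat 1) \<noteq> 0"
proof
  assume "det (hessian V d - mat 1) = 0"
  then have "\<not> (\<exists>B. B ** (hessian V d - mat 1) = mat 1)"
    unfolding invertible_left_inverse[symmetric] invertible_det_nz by simp
  then obtain v where v: "(hessian V d - mat 1) *v v = 0" "v \<noteq> 0"
    unfolding matrix_left_invertible_ker by blast
  then have Hv: "hessian V d *v v = v"
    by (simp add: matrix_vector_mult_diff_rdistrib)
  have Hd: "hessian V d *v d = of_nat (k - 1) *s d"
    by (simp add: hessian_mult_self[OF hom] d)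
  obtain l where l: "d $ l \<noteq> 0" and rank:
    "rank (\<chi> a j. eval_poly (partial j (dehomogenise l (darboux_eqs V a))) (inverse (d $ l) *s d))
       = CARD('n) - 1" (is "rank ?K = _")
    using simple unfolding simple_point_def by blast
  have k1: "k - 1 = Suc (k - 2)" using k by simp
  define e where "e = inverse (d $ l)"
  define p where "p = e *s d"
  have p1: "p $ l = 1" using l by (simp add: p_def e_def)
  define \<beta> where "\<beta> = v $ l / d $ l"
  define w where "w = v - \<beta> *s d"
  have wl: "w $ l = 0" using l by (simp add: w_def \<beta>_def)
  have Hw: "hessian V d *v w = w - (\<beta> * of_nat (k - 2)) *s d"
  proof -
    have "of_nat (k - 1) = (of_nat (k - 2) + 1 :: complex)"
      unfolding k1 by simp
    moreover have "hessian V d *v (\<beta> *s d) = \<beta> *s (hessian V d *v d)"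
      by (simp add: vec_eq_iff matrix_vector_mult_def sum_distrib_left mult.left_commute)
    ultimately have "hessian V d *v w = v - \<beta> *s ((of_nat (k - 2) + 1) *s d)"
      unfolding w_def matrix_vector_mult_diff_distrib Hv Hd by simp
    also have "\<dots> = w - (\<beta> * of_nat (k - 2)) *s d"
      by (simp add: w_def vec_eq_iff algebra_simps)
    finally show ?thesis .
  qed
  \<comment> \<open>Otherwise \<open>v\<close> would be a multiple of \<open>d\<close>, although
    their eigenvalues 1 and k - 1 differ for k > 2.\<close>
  have "w \<noteq> 0"
  proof
    assume "w = 0"
    with Hw have "(\<beta> * of_nat (k - 2)) *s d = 0" by simp
    moreover have "of_nat (k - 2) \<noteq> (0 :: complex)"
      using k unfolding of_nat_eq_0_iff by simp
    ultimately have "\<beta> = 0" using d(2) unfolding vector_mul_eq_0 mult_eq_0_iff by blast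
    with \<open>w = 0\<close> v(2) show False by (simp add: w_def)
  qed
  have grad: "gradient V p = e ^ (k - 1) *s d"
    by (simp add: p_def gradient_scale[OF hom] d)
  have hess: "hessian V p *v w = e ^ (k - 2) *s (w - (\<beta> * of_nat (k - 2)) *s d)"
    unfolding Hw[symmetric]
    by (simp add: p_def vec_eq_iff matrix_vector_mult_def hessian_scale[OF hom] sum_distrib_left mult.assoc)
  have ee: "e * e ^ (k - 2) = e ^ (k - 1)"
    unfolding k1 by simp
  have "?K *v w = 0"
  proof -
    have "(?K *v w) $ (i, j) = 0" for i j
    proof -
      have "(?K *v w) $ (i, j) = (\<Sum>c\<in>UNIV. eval_poly (partial c (darboux_eqs V (i, j))) p * w $ c)"
        unfolding matrix_vector_mult_def p_def[symmetric] e_def[symmetric]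
        by (simp add: eval_partial_dehomogenise[OF p1]) (rule sum.cong, auto simp: wl)
      also have "\<dots> = 0"
        unfolding eval_partial_darboux_eqs grad hess ee[symmetric]
        by (simp add: p_def algebra_simps)
      finally show ?thesis .
    qed
    then show ?thesis by (simp add: vec_eq_iff split_paired_all)
  qed
  moreover have "?K $ a $ l = 0" for a
    using eval_partial_dehomogenise[OF p1] by (simp add: p_def e_def)
  ultimately have "rank ?K + 2 \<le> CARD('n)"
    using wl \<open>w \<noteq> 0\<close> by (intro rank_le_of_kernel[of ?K l w])
  with rank show False by simp
qed

subsection \<open>Normalised representatives\<close>

lemma proj_point_self: "d \<in> proj_point d"
  unfolding proj_point_def by (rule CollectI, rule exI[of _ 1]) simp

lemma proj_point_scale:
  assumes "c \<noteq> 0"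
  shows "proj_point (c *s d) = proj_point d"
proof (intro equalityI subsetI)
  fix x assume "x \<in> proj_point (c *s d)"
  then obtain b where "b \<noteq> 0" "x = b *s (c *s d)" by (auto simp: proj_point_def)
  then show "x \<in> proj_point d"
    using assms unfolding proj_point_def
    by (intro CollectI exI[of _ "b * c"]) simp
next
  fix x assume "x \<in> proj_point d"
  then obtain b where "b \<noteq> 0" "x = b *s d" by (auto simp: proj_point_def)
  then show "x \<in> proj_point (c *s d)"
    using assms unfolding proj_point_def
    by (intro CollectI exI[of _ "b / c"]) simp
qed

text \<open>If V'(d) = \<gamma> d, a nonzero multiple c d is normalised when c^(k-2) = 1/\<gamma>.
  This is solvable because properness gives \<gamma> \<noteq> 0.\<close>

lemma darboux_rep:
  assumes k: "k > 2" and hom: "homogeneous k V" and P: "P \<in> proper_darboux_points V"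
  shows "darboux_rep V P \<in> P" "gradient V (darboux_rep V P) = darboux_rep V P"
    "darboux_rep V P \<noteq> 0" "proj_point (darboux_rep V P) = P"
proof -
  obtain d where d: "is_proper_darboux V d" and Pd: "P = proj_point d"
    using P by (auto simp: proper_darboux_points_def)
  then obtain \<gamma> where \<gamma>: "gradient V d = \<gamma> *s d" "\<gamma> \<noteq> 0" "d \<noteq> 0"
    by (auto simp: is_proper_darboux_def is_darboux_def)
  have "card {z. z ^ (k - 2) = inverse \<gamma>} \<noteq> 0"
    using \<gamma> k by (subst card_nth_roots) auto
  then have "{z. z ^ (k - 2) = inverse \<gamma>} \<noteq> {}" by (intro notI) simp
  then obtain c where c: "c ^ (k - 2) = inverse \<gamma>" by blast
  then have "c \<noteq> 0" using \<gamma> k by (auto simp: power_0_left)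
  have "k - 1 = Suc (k - 2)" using k by simp
  then have "c ^ (k - 1) = c * c ^ (k - 2)" by (simp only: power_Suc)
  then have "gradient V (c *s d) = c *s d"
    using \<gamma> by (simp add: gradient_scale[OF hom] c)
  moreover have "c *s d \<in> P"
    using \<open>c \<noteq> 0\<close> unfolding Pd proj_point_def by blast
  ultimately have "darboux_rep V P \<in> P \<and> gradient V (darboux_rep V P) = darboux_rep V P"
    unfolding darboux_rep_def by (intro someI[of "\<lambda>d. d \<in> P \<and> gradient V d = d" "c *s d"] conjI)
  then show 1: "darboux_rep V P \<in> P" and "gradient V (darboux_rep V P) = darboux_rep V P"
    by blast+
  from 1 obtain b where "b \<noteq> 0" "darboux_rep V P = b *s d"
    unfolding Pd proj_point_def by blast
  then show "darboux_rep V P \<noteq> 0" and "proj_point (darboux_rep V P) = P"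
    using \<gamma> by (simp_all add: Pd proj_point_scale vector_mul_eq_0)
qed

text \<open>The normalised points on a line differ by (k-2)-th roots of unity, and the Hessian is
  homogeneous of degree k - 2.\<close>

lemma card_normalised_representatives:
  assumes k: "k > 2" and hom: "homogeneous k V" and d: "gradient V d = d" "d \<noteq> 0"
  shows "card {x. gradient V x = x \<and> x \<noteq> 0 \<and> proj_point x = proj_point d} = k - 2"
    and "gradient V x = x \<Longrightarrow> x \<noteq> 0 \<Longrightarrow> proj_point x = proj_point d \<Longrightarrow> hessian V x = hessian V d"
proof -
  have "k - 1 = Suc (k - 2)" using k by simp
  then have kk: "c ^ (k - 1) = c * c ^ (k - 2)" for c :: complex by (simp only: power_Suc)
  have eq: "{x. gradient V x = x \<and> x \<noteq> 0 \<and> proj_point x = proj_point d}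
      = (\<lambda>c. c *s d) ` {c. c ^ (k - 2) = 1}"
  proof (intro equalityI subsetI)
    fix x assume x: "x \<in> {x. gradient V x = x \<and> x \<noteq> 0 \<and> proj_point x = proj_point d}"
    then have "x \<in> proj_point d" using proj_point_self[of x] by simp
    then obtain c where c: "x = c *s d" "c \<noteq> 0" by (auto simp: proj_point_def)
    have "(c ^ (k - 1) - c) *s d = 0"
      using x by (simp add: c gradient_scale[OF hom] d vector_sub_rdistrib)
    then have "c ^ (k - 1) = c" using d by (simp add: vector_mul_eq_0)
    then have "c ^ (k - 2) = 1" using c unfolding kk by simp
    with c show "x \<in> (\<lambda>c. c *s d) ` {c. c ^ (k - 2) = 1}" by blast
  next
    fix x assume "x \<in> (\<lambda>c. c *s d) ` {c. c ^ (k - 2) = 1}"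
    then obtain c where c: "x = c *s d" "c ^ (k - 2) = 1" by blast
    then have "c \<noteq> 0" using k by (auto simp: power_0_left)
    moreover have "c ^ (k - 1) = c" using c kk[of c] by simp
    then have "gradient V x = x"
      unfolding c(1) gradient_scale[OF hom] d by simp
    ultimately show "x \<in> {x. gradient V x = x \<and> x \<noteq> 0 \<and> proj_point x = proj_point d}"
      using c d(2) by (simp add: proj_point_scale vector_mul_eq_0)
  qed
  have "inj_on (\<lambda>c. c *s d) {c. c ^ (k - 2) = 1}"
    using d by (intro inj_onI) (simp add: vector_mul_rcancel)
  then show "card {x. gradient V x = x \<and> x \<noteq> 0 \<and> proj_point x = proj_point d} = k - 2"
    unfolding eq using k by (simp add: card_image card_roots_unity_eq)
  assume "gradient V x = x" "x \<noteq> 0" "proj_point x = proj_point d"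
  then have "x \<in> (\<lambda>c. c *s d) ` {c. c ^ (k - 2) = 1}" unfolding eq[symmetric] by simp
  then obtain c where "x = c *s d" "c ^ (k - 2) = 1" by blast
  then have "hessian V (c *s d) = hessian V d"
    by (simp add: vec_eq_iff hessian_scale[OF hom])
  then show "hessian V x = hessian V d" by (simp only: \<open>x = c *s d\<close>)
qed

text \<open>The solutions other than 0 are grouped by the line they span; on each group
  \<open>f\<close> is constant because the Hessian is.\<close>

lemma sum_normalised_representatives:
  fixes f :: "complex^'n::finite \<Rightarrow> complex"
  assumes k: "k > 2" and hom: "homogeneous k V"
    and fin: "finite {a. gradient V a = a}"
    and f: "\<And>a b. gradient V a = a \<Longrightarrow> gradient V b = b \<Longrightarrow> hessian V a = hessian V b \<Longrightarrow> f a = f b"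
  shows "(\<Sum>a | gradient V a = a. f a)
    = f 0 + of_nat (k - 2) * (\<Sum>P\<in>proper_darboux_points V. f (darboux_rep V P))"
proof -
  let ?Z = "{a. gradient V a = a}"
  have img: "proj_point ` (?Z - {0}) = proper_darboux_points V"
  proof (intro equalityI subsetI)
    fix P assume "P \<in> proj_point ` (?Z - {0})"
    then obtain d where d: "P = proj_point d" "gradient V d = d" "d \<noteq> 0" by auto
    then have "gradient V d = 1 *s d" "gradient V d \<noteq> 0" by simp_all
    with d(3) have "is_proper_darboux V d"
      unfolding is_proper_darboux_def is_darboux_def by blast
    with d(1) show "P \<in> proper_darboux_points V" unfolding proper_darboux_points_def by blast
  next
    fix P assume P: "P \<in> proper_darboux_points V"
    show "P \<in> proj_point ` (?Z - {0})"
      using darboux_rep[OF k hom P] by (intro image_eqI[of _ _ "darboux_rep V P"]) simp_all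
  qed
  have "gradient V 0 = 0"
    using gradient_scale[OF hom, of 0 0] k by (simp add: power_0_left)
  then have "(\<Sum>a\<in>?Z. f a) = f 0 + (\<Sum>a\<in>?Z - {0}. f a)"
    using fin by (intro sum.remove) auto
  also have "(\<Sum>a\<in>?Z - {0}. f a)
      = (\<Sum>P\<in>proper_darboux_points V. \<Sum>a | a \<in> ?Z - {0} \<and> proj_point a = P. f a)"
    by (rule sum.group[symmetric]) (simp_all only: img[symmetric] finite_imageI finite_Diff fin subset_refl)
  also have "\<dots> = (\<Sum>P\<in>proper_darboux_points V. of_nat (k - 2) * f (darboux_rep V P))"
  proof (rule sum.cong[OF refl])
    fix P assume P: "P \<in> proper_darboux_points V"
    note rep = darboux_rep[OF k hom P]
    note card = card_normalised_representatives[OF k hom rep(2,3)]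
    have "(\<Sum>a | a \<in> ?Z - {0} \<and> proj_point a = P. f a)
        = (\<Sum>a | gradient V a = a \<and> a \<noteq> 0 \<and> proj_point a = proj_point (darboux_rep V P). f (darboux_rep V P))"
    proof (rule sum.cong)
      fix a assume "a \<in> {a. gradient V a = a \<and> a \<noteq> 0 \<and> proj_point a = proj_point (darboux_rep V P)}"
      then show "f a = f (darboux_rep V P)"
        using rep(2) card(2)[of a] by (intro f) simp_all
    qed (use rep(4) in auto)
    then show "(\<Sum>a | a \<in> ?Z - {0} \<and> proj_point a = P. f a) = of_nat (k - 2) * f (darboux_rep V P)"
      by (simp only: sum_constant card(1))
  qed
  finally show ?thesis by (simp add: sum_distrib_left)
qed

subsection \<open>Residue sums over the Darboux points\<close>

text \<open>By Euler's identity for the gradient, \<open>d\<close> is an eigenvector for k - 1. So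
  the multiset difference in \<open>Lambda\<close> does remove one eigenvalue.\<close>

lemma eigenvalues_hessian:
  fixes d :: "complex^'n::finite"
  assumes k: "k > 2" and hom: "homogeneous k V" and d: "gradient V d = d" "d \<noteq> 0"
  shows "eigenvalues (hessian V d) = add_mset (of_nat k - 1) (mset (map (\<lambda>y. y + 1) (Lambda k V d)))"
proof -
  define M where "M = eigenvalues (hessian V d) - {#of_nat k - 1#}"
  have "hessian V d *v d = (of_nat k - 1) *s d"
    using hessian_mult_self[OF hom, of d] k by (simp add: d of_nat_diff)
  then have "of_nat k - 1 \<in># eigenvalues (hessian V d)"
    using d(2) by (rule eigenvalueI)
  then have "eigenvalues (hessian V d) = add_mset (of_nat k - 1) M"
    by (simp add: M_def)
  moreover have "mset (SOME zs. mset zs = M) = M"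
    by (rule someI_ex) (rule ex_mset)
  then have "mset (map (\<lambda>y. y + 1) (Lambda k V d)) = M"
    unfolding Lambda_def M_def[symmetric] by (simp add: image_mset.compositionality comp_def)
  ultimately show ?thesis by simp
qed

lemma length_Lambda:
  fixes d :: "complex^'n::finite"
  assumes "k > 2" "homogeneous k V" "gradient V d = d" "d \<noteq> 0"
  shows "length (Lambda k V d) = CARD('n) - 1"
  using arg_cong[OF eigenvalues_hessian[OF assms], of size] by (simp add: size_eigenvalues)

lemma det_identity_plus_hessian:
  fixes d :: "complex^'n::finite"
  assumes "k > 2" "homogeneous k V" "gradient V d = d" "d \<noteq> 0"
  shows "det (\<chi> i j. (if i = j then 1 else 0) + t * (hessian V d $ i $ j - (if i = j then 1 else 0)))
    = (1 + t * (of_nat k - 2)) * (\<Sum>r\<le>CARD('n) - 1. tau r (Lambda k V d) * t ^ r)"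
proof -
  have "(\<Prod>x\<in>#eigenvalues (hessian V d). 1 + t * (x - 1))
      = (1 + t * (of_nat k - 2)) * (\<Prod>y\<leftarrow>Lambda k V d. 1 + t * y)"
  proof -
    have "(\<Prod>x\<in>#mset (map (\<lambda>y. y + 1) ys). 1 + t * (x - 1)) = (\<Prod>y\<leftarrow>ys. 1 + t * y)" for ys :: "complex list"
      by (induction ys) simp_all
    moreover have "of_nat k - 1 - 1 = (of_nat k - 2 :: complex)" by simp
    ultimately show ?thesis
      unfolding eigenvalues_hessian[OF assms] by (simp only: image_mset_add_mset prod_mset.add_mset)
  qed
  then show ?thesis
    unfolding det_identity_plus prod_list_one_plus length_Lambda[OF assms] .
qed

lemma det_hessian_minus_identity:
  fixes d :: "complex^'n::finite"
  assumes "k > 2" "homogeneous k V" "gradient V d = d" "d \<noteq> 0"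
  shows "det (\<chi> i j. hessian V d $ i $ j - (if i = j then 1 else 0))
    = (of_nat k - 2) * tau (CARD('n) - 1) (Lambda k V d)"
proof -
  have "(\<Prod>x\<in>#eigenvalues (hessian V d). x - 1) = (of_nat k - 2) * prod_list (Lambda k V d)"
    unfolding eigenvalues_hessian[OF assms]
    by (simp add: prod_mset_prod_list image_mset.compositionality comp_def)
  then show ?thesis
    unfolding det_minus_identity length_Lambda[OF assms, symmetric] tau_length .
qed

lemma tau_1_Lambda:
  fixes d :: "complex^'n::finite"
  assumes "k > 2" "homogeneous k V" "gradient V d = d" "d \<noteq> 0"
  shows "tau 1 (Lambda k V d) = trace (hessian V d) - of_nat CARD('n) - (of_nat k - 2)"
proof -
  have "\<Sum>\<^sub># (mset (map (\<lambda>y. y + 1) ys)) = sum_list ys + of_nat (length ys)" for ys :: "complex list"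
    by (induction ys) simp_all
  then have "trace (hessian V d) = of_nat k - 1 + (sum_list (Lambda k V d) + of_nat (CARD('n) - 1))"
    unfolding sum_eigenvalues[symmetric] eigenvalues_hessian[OF assms] length_Lambda[OF assms, symmetric]
    by (simp del: mset_map)
  moreover have "of_nat (CARD('n) - 1) = (of_nat CARD('n) - 1 :: complex)"
    by (simp add: of_nat_diff Suc_leI)
  ultimately show ?thesis by (simp add: tau_1[unfolded One_nat_def])
qed

lemma hpart_Const_mult: "hpart d (Const c * p) = Const c * hpart d p"
  using hpart_mult_homogeneous[of 0 "Const c" d p] by (simp add: hpart_single mult.commute)

text \<open>The vanishing theorem for V'(q) - q. The origin contributes g(0) / (-1)^n. By
  \<open>g_hessian\<close> each Darboux point contributes k - 2 equal summands, and this factor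
  cancels against the k - 2 in the determinant.\<close>

lemma sum_over_darboux_points:
  fixes V :: "'n::finite cpoly"
  assumes k: "k > 2" and hom: "homogeneous k V"
    and proper: "\<And>d. is_darboux V d \<Longrightarrow> is_proper_darboux V d"
    and simple: "\<And>d. is_darboux V d \<Longrightarrow> simple_point (darboux_eqs V) d"
    and g: "deg_le e g" "e < CARD('n) * (k - 2)"
    and g_hessian: "\<And>a b. hessian V a = hessian V b \<Longrightarrow> eval_poly g a = eval_poly g b"
  shows "(\<Sum>P\<in>proper_darboux_points V.
      eval_poly g (darboux_rep V P) / tau (CARD('n) - 1) (Lambda k V (darboux_rep V P)))
    = (- 1) ^ (CARD('n) - 1) * eval_poly g 0"
    and "P \<in> proper_darboux_points V \<Longrightarrow> tau (CARD('n) - 1) (Lambda k V (darboux_rep V P)) \<noteq> 0"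
proof -
  define F where "F i = partial i V - variable i" for i
  define D where "D a = det (\<chi> i j. hessian V a $ i $ j - (if i = j then 1 else 0))" for a
  have "is_darboux V d" if "gradient V d = \<gamma> *s d" "d \<noteq> 0" for d \<gamma>
    using that unfolding is_darboux_def by blast
  note darboux = this
  have kk: "k - 1 \<noteq> 1" "k - 2 \<noteq> 0" "k - 1 - 1 = k - 2" using k by simp_all
  have F0: "(\<forall>i. eval_poly (F i) a = 0) \<longleftrightarrow> gradient V a = a" for a
    by (simp add: F_def eval_poly_diff gradient_def vec_eq_iff)
  have Jac: "det (\<chi> i j. eval_poly (partial j (F i)) a) = D a" for a
  proof -
    have "eval_poly (partial j (F i)) a = hessian V a $ i $ j - (if i = j then 1 else 0)" for i j
      by (simp add: F_def partial_diff partial_variable eval_poly_diff hessian_def)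
    then show ?thesis by (simp add: D_def)
  qed
  have degF: "deg_le (k - 1) (F i)" for i
    unfolding F_def using k
    by (intro deg_le_diff homogeneous_deg_le homogeneous_partial[OF hom] deg_le_variable) simp
  have hF: "hpart (k - 1) (F i) = partial i V" for i
    using homogeneous_partial[OF hom] kk(1)
    unfolding F_def hpart_diff homogeneous_iff_hpart by (simp add: variable_def hpart_single)
  \<comment> \<open>A nonzero common zero of the leading forms would be an improper Darboux point,
    with \<gamma> = 0.\<close>
  have top: "x = 0" if "\<And>i. eval_poly (hpart (k - 1) (F i)) x = 0" for x
  proof (rule ccontr)
    assume "x \<noteq> 0"
    have "gradient V x = 0" using that unfolding hF
      by (simp add: gradient_def vec_eq_iff)
    with darboux[of x 0] \<open>x \<noteq> 0\<close> have "is_darboux V x" by simp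
    from proper[OF this] \<open>gradient V x = 0\<close> show False by (simp add: is_proper_darboux_def)
  qed
  have hess0: "hessian V 0 = 0"
    using hessian_scale[OF hom, of 0 0] kk(2) by (simp add: vec_eq_iff power_0_left)
  have D0: "D 0 = (- 1) ^ CARD('n)"
  proof -
    have "D 0 = (\<Prod>i\<in>(UNIV :: 'n set). - 1)"
      unfolding D_def hess0 by (subst det_diagonal) simp_all
    then show ?thesis by simp
  qed
  \<comment> \<open>At the origin the Hessian vanishes because k > 2; at the other solutions
    simplicity of the Darboux point applies.\<close>
  have nz: "D a \<noteq> 0" if "gradient V a = a" for a
  proof (cases "a = 0")
    case False
    have "is_darboux V a" by (rule darboux[of a 1]) (use that False in simp_all)
    then have "det (hessian V a - mat 1) \<noteq> 0"
      using simple_point_imp_det_hessian[OF k hom that False] simple by blast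
    moreover have "hessian V a - mat 1 = (\<chi> i j. hessian V a $ i $ j - (if i = j then 1 else 0))"
      by (simp add: vec_eq_iff mat_def)
    ultimately show ?thesis by (simp add: D_def)
  qed (simp add: D0)
  have Dtau: "D (darboux_rep V P) = (of_nat k - 2) * tau (CARD('n) - 1) (Lambda k V (darboux_rep V P))"
    if "P \<in> proper_darboux_points V" for P
    unfolding D_def using darboux_rep[OF k hom that] by (intro det_hessian_minus_identity k hom)
  show "tau (CARD('n) - 1) (Lambda k V (darboux_rep V P)) \<noteq> 0" if "P \<in> proper_darboux_points V"
    using Dtau[OF that] nz[OF darboux_rep(2)[OF k hom that]] by auto
  have lt: "e < CARD('n) * (k - 1 - 1)" unfolding kk(3) by (rule g(2))
  have nondeg: "det (\<chi> i j. eval_poly (partial j (F i)) a) \<noteq> 0" if "\<And>i. eval_poly (F i) a = 0" for a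
    unfolding Jac using that F0 nz by blast
  note ej = euler_jacobi[OF degF top nondeg g(1) lt, unfolded F0 Jac]
  have k2: "of_nat (k - 2) = (of_nat k - 2 :: complex)" "of_nat k - 2 \<noteq> (0 :: complex)"
    using k of_nat_eq_0_iff[of "k - 2", where ?'a = complex] by (simp_all add: of_nat_diff)
  have "0 = (\<Sum>a | gradient V a = a. eval_poly g a / D a)"
    by (rule ej(2)[symmetric])
  also have "\<dots> = eval_poly g 0 / D 0
      + of_nat (k - 2) * (\<Sum>P\<in>proper_darboux_points V. eval_poly g (darboux_rep V P) / D (darboux_rep V P))"
  proof (rule sum_normalised_representatives[OF k hom ej(1)])
    fix a b assume "hessian V a = hessian V b"
    then show "eval_poly g a / D a = eval_poly g b / D b"
      using g_hessian[of a b] by (simp add: D_def)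
  qed
  also have "of_nat (k - 2) * (\<Sum>P\<in>proper_darboux_points V. eval_poly g (darboux_rep V P) / D (darboux_rep V P))
      = (\<Sum>P\<in>proper_darboux_points V. eval_poly g (darboux_rep V P) / tau (CARD('n) - 1) (Lambda k V (darboux_rep V P)))"
    unfolding sum_distrib_left k2(1)
    by (rule sum.cong) (use k2(2) in \<open>simp_all add: Dtau\<close>)
  finally have "(\<Sum>P\<in>proper_darboux_points V. eval_poly g (darboux_rep V P) / tau (CARD('n) - 1) (Lambda k V (darboux_rep V P)))
      = - (eval_poly g 0 / (- 1) ^ CARD('n))"
    by (simp only: D0 eq_neg_iff_add_eq_0 add.commute)
  also have "\<dots> = (- 1) ^ (CARD('n) - 1) * eval_poly g 0"
    by (cases "CARD('n)") (simp_all add: field_simps minus_one_power_iff)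
  finally show "(\<Sum>P\<in>proper_darboux_points V. eval_poly g (darboux_rep V P) / tau (CARD('n) - 1) (Lambda k V (darboux_rep V P)))
      = (- 1) ^ (CARD('n) - 1) * eval_poly g 0" .
qed

text \<open>Pascal's rule turns the sum of two consecutive terms into one with upper index n - i.
  Splitting off its summand i = 0 and shifting leaves \<open>x\<close> times the earlier
  term.\<close>

lemma sum_binomial_powers_recurrence:
  fixes x :: "'a::comm_ring_1"
  assumes "Suc r < n"
  shows "(\<Sum>i = 0..Suc r. of_nat ((n - i - 1) choose (Suc r - i)) * x ^ i)
    = of_nat (n choose Suc r) + (x - 1) * (\<Sum>i = 0..r. of_nat ((n - i - 1) choose (r - i)) * x ^ i)"
proof -
  let ?U = "\<lambda>r. \<Sum>i = 0..r. of_nat ((n - i - 1) choose (r - i)) * x ^ i"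
  \<comment> \<open>The summand i = Suc r has lower index 0, where Pascal's rule does not apply; it
    is kept apart as \<open>x ^ Suc r\<close>.\<close>
  have "?U r + ?U (Suc r) = (\<Sum>i = 0..r. of_nat ((n - i) choose (Suc r - i)) * x ^ i) + x ^ Suc r"
  proof -
    have "of_nat ((n - i - 1) choose (r - i)) * x ^ i + of_nat ((n - i - 1) choose (Suc r - i)) * x ^ i
        = of_nat ((n - i) choose (Suc r - i)) * x ^ i" if "i \<le> r" for i
    proof -
      have "n - i = Suc (n - i - 1)" "Suc r - i = Suc (r - i)" using that assms by simp_all
      then have "(n - i) choose (Suc r - i) = ((n - i - 1) choose (r - i)) + ((n - i - 1) choose (Suc r - i))"
        by (metis binomial_Suc_Suc)
      then show ?thesis by (simp add: distrib_right)
    qed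
    then show ?thesis by (simp add: add.assoc[symmetric] sum.distrib[symmetric])
  qed
  also have "\<dots> = (\<Sum>i = 0..Suc r. of_nat ((n - i) choose (Suc r - i)) * x ^ i)"
    by simp
  also have "\<dots> = of_nat (n choose Suc r) + x * ?U r"
    by (subst sum.atLeast0_atMost_Suc_shift) (simp add: sum_distrib_left mult.left_commute)
  finally show ?thesis by (simp add: algebra_simps)
qed

text \<open>Up to the alternating sign, \<open>S\<close> satisfies the recurrence of the binomial
  sums. It is applied with x = k - 1.\<close>

lemma recurrence_solution:
  fixes S :: "nat \<Rightarrow> complex"
  assumes S0: "S 0 = - ((- 1) ^ n)"
    and S: "\<And>r. Suc r < n \<Longrightarrow> S (Suc r) + (x - 1) * S r = - (of_nat (n choose Suc r) * (- 1) ^ (n - Suc r))"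
    and "r < n"
  shows "S r = (- 1) ^ (r + n - 1) * (\<Sum>i = 0..r. of_nat ((n - i - 1) choose (r - i)) * x ^ i)"
  using \<open>r < n\<close>
proof (induction r)
  case 0
  then show ?case by (cases n) (simp_all add: S0)
next
  case (Suc r)
  let ?U = "\<lambda>r. \<Sum>i = 0..r. of_nat ((n - i - 1) choose (r - i)) * x ^ i"
  obtain m where n: "n = Suc r + m" using Suc.prems less_imp_add_positive by blast
  have sgn: "(- 1) ^ (n - Suc r) = - ((- 1) ^ (r + n) :: complex)" "(- 1) ^ (r + n - 1) = - ((- 1) ^ (r + n) :: complex)"
    by (simp_all add: n power_add)
  have "S (Suc r) = - (of_nat (n choose Suc r) * (- 1) ^ (n - Suc r)) - (x - 1) * S r"
    using S[OF Suc.prems] by (simp add: eq_diff_eq)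
  also have "\<dots> = (- 1) ^ (r + n) * (of_nat (n choose Suc r) + (x - 1) * ?U r)"
    unfolding Suc.IH[OF Suc_lessD[OF Suc.prems]] sgn by (simp add: algebra_simps)
  finally show ?case
    unfolding sum_binomial_powers_recurrence[OF Suc.prems] by simp
qed

lemma coeff_pCons2_mult: "coeff ([:1, b:] * Q) r = coeff Q r + b * (if r = 0 then 0 else coeff Q (r - 1))"
  for Q :: "complex poly"
  by (cases r) (simp_all add: mult_pCons_left)

theorem theorem3p1:
  fixes V :: "'n::finite cpoly" and k :: nat
  assumes n: "CARD('n) \<ge> 2"
    and k: "k > 2"
    and hom: "homogeneous k V"
    and proper: "\<And>d. is_darboux V d \<Longrightarrow> is_proper_darboux V d"
    and simple: "\<And>d. is_darboux V d \<Longrightarrow> simple_point (darboux_eqs V) d"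
  shows "\<forall>r \<le> CARD('n) - 1.
      (\<Sum>P\<in>proper_darboux_points V.
          tau 1 (Lambda k V (darboux_rep V P)) ^ r
            / tau (CARD('n) - 1) (Lambda k V (darboux_rep V P)))
        = (- 1) ^ (CARD('n) - 1) * (- of_nat CARD('n) - (of_nat k - 2)) ^ r
    \<and> (\<Sum>P\<in>proper_darboux_points V.
          tau r (Lambda k V (darboux_rep V P))
            / tau (CARD('n) - 1) (Lambda k V (darboux_rep V P)))
        = (- 1) ^ (r + CARD('n) - 1)
            * (\<Sum>i = 0..r. of_nat ((CARD('n) - i - 1) choose (r - i)) * (of_nat k - 1) ^ i)"
proof (intro allI impI)
  fix r assume r: "r \<le> CARD('n) - 1"
  have rep: "gradient V (darboux_rep V P) = darboux_rep V P" "darboux_rep V P \<noteq> 0"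
    if "P \<in> proper_darboux_points V" for P
    using darboux_rep[OF k hom that] by simp_all
  have hess0: "hessian V 0 = 0"
    using hessian_scale[OF hom, of 0 0] k by (simp add: vec_eq_iff power_0_left)
  have hom2: "homogeneous (k - 2) (partial j (partial i V))" for i j
    using homogeneous_partial[OF homogeneous_partial[OF hom]] by (simp add: numeral_2_eq_2)

  \<comment> \<open>Sums of powers of \<tau>_1\<close>
  have "(\<Sum>P\<in>proper_darboux_points V.
          tau 1 (Lambda k V (darboux_rep V P)) ^ r / tau (CARD('n) - 1) (Lambda k V (darboux_rep V P)))
        = (- 1) ^ (CARD('n) - 1) * (- of_nat CARD('n) - (of_nat k - 2)) ^ r"
  proof -
    \<comment> \<open>At a normalised point the base of this power is \<tau>_1. Second derivatives
      have degree k - 2, so r \<le> n - 1 keeps the degree of \<open>g\<close> below n (k -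
      2).\<close>
    define g :: "'n cpoly" where
      "g = ((\<Sum>i\<in>UNIV. partial i (partial i V)) - Const (of_nat CARD('n) + (of_nat k - 2))) ^ r"
    have ev: "eval_poly g a = (trace (hessian V a) - of_nat CARD('n) - (of_nat k - 2)) ^ r" for a
      by (simp add: g_def eval_poly_simps trace_def hessian_def diff_diff_eq)
    have "deg_le (r * (k - 2)) g"
      unfolding g_def by (intro deg_le_power deg_le_diff deg_le_sum homogeneous_deg_le hom2 deg_le_Const)
    moreover have "r * (k - 2) < CARD('n) * (k - 2)"
      using r n k by (intro mult_strict_right_mono) auto
    ultimately have "(\<Sum>P\<in>proper_darboux_points V.
          eval_poly g (darboux_rep V P) / tau (CARD('n) - 1) (Lambda k V (darboux_rep V P)))
        = (- 1) ^ (CARD('n) - 1) * eval_poly g 0"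
      by (intro sum_over_darboux_points(1)[OF k hom proper simple]) (simp_all only: ev)
    moreover have "eval_poly g (darboux_rep V P) = tau 1 (Lambda k V (darboux_rep V P)) ^ r"
      if "P \<in> proper_darboux_points V" for P
      unfolding ev tau_1_Lambda[OF k hom rep[OF that]] ..
    moreover have "eval_poly g 0 = (- of_nat CARD('n) - (of_nat k - 2)) ^ r"
      by (simp add: ev hess0 trace_def)
    ultimately show ?thesis by simp
  qed
  moreover

  \<comment> \<open>Sums of the \<tau>_r through their generating function\<close>
  define S where "S r = (\<Sum>P\<in>proper_darboux_points V.
      tau r (Lambda k V (darboux_rep V P)) / tau (CARD('n) - 1) (Lambda k V (darboux_rep V P)))" for r
  have "S r = (- 1) ^ (r + CARD('n) - 1)
      * (\<Sum>i = 0..r. of_nat ((CARD('n) - i - 1) choose (r - i)) * (of_nat k - 1) ^ i)"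
  proof -
    define N where "N = CARD('n) * (k - 2)"
    have "N \<ge> 1" using k by (simp add: N_def Suc_leI)
    \<comment> \<open>Collects what t^n det B contributes at the Darboux points; it enters only the
      coefficient of t^n.\<close>
    define C where "C = ((of_nat k - 2) * of_nat (card (proper_darboux_points V)) :: complex)"
    have key: "(1 + t * (of_nat k - 2)) * (\<Sum>r\<le>CARD('n) - 1. S r * t ^ r)
        = (C + 1) * t ^ CARD('n) - (t - 1) ^ CARD('n)" for t
    proof -
      define H :: "'n cpoly^'n^'n" where "H = (\<chi> i j. partial j (partial i V))"
      define A where "A = (\<chi> i j. (if i = j then 1 else 0) + Const t * (H $ i $ j - (if i = j then 1 else 0)))"
      define B where "B = (\<chi> i j. H $ i $ j - (if i = j then 1 else 0))"
      \<comment> \<open>Each term alone may reach the excluded degree n (k - 2). Their parts of that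
        degree are both t^n det H and cancel.\<close>
      define g where "g = det A - Const (t ^ CARD('n)) * det B"
      have degH: "deg_le (k - 2) (H $ i $ j)" for i j
        by (simp add: H_def homogeneous_deg_le hom2)
      have degB: "deg_le (k - 2) (B $ i $ j)" for i j
        using degH by (simp add: B_def deg_le_diff)
      have "deg_le (0 + (k - 2)) (Const t * B $ i $ j)" for i j
        by (intro deg_le_mult degB deg_le_Const)
      then have degA: "deg_le (k - 2) (A $ i $ j)" for i j
        by (simp add: A_def B_def deg_le_add)
      have hB: "hpart (k - 2) (B $ i $ j) = H $ i $ j" for i j
        using hom2 k by (simp add: B_def H_def hpart_diff hpart_1 homogeneous_iff_hpart)
      have hA: "hpart (k - 2) (A $ i $ j) = Const t * H $ i $ j" for i j
        using hom2 k by (simp add: A_def H_def hpart_add hpart_diff hpart_1 hpart_Const_mult homogeneous_iff_hpart)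
      have "hpart N (det A) = det (\<chi> i. Const t *s H $ i)"
        unfolding N_def hpart_det[OF degA] hA by (simp add: vector_scalar_mult_def)
      also have "\<dots> = Const (t ^ CARD('n)) * det H"
      proof -
        have "Const t ^ e = (Const (t ^ e) :: 'n cpoly)" for e
          by (induction e) (simp_all add: mult_single)
        then show ?thesis unfolding det_rows_mul by simp
      qed
      also have "det H = hpart N (det B)"
        unfolding N_def hpart_det[OF degB] hB by simp
      finally have "hpart N g = 0"
        by (simp add: g_def hpart_diff hpart_Const_mult)
      moreover have "deg_le N g"
      proof -
        have "deg_le (0 + N) (Const (t ^ CARD('n)) * det B)"
          unfolding N_def by (intro deg_le_mult deg_le_det degB deg_le_Const)
        moreover have "deg_le N (det A)" unfolding N_def by (intro deg_le_det degA)
        ultimately show ?thesis by (simp add: g_def deg_le_diff)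
      qed
      ultimately have deg: "deg_le (N - 1) g"
        using deg_le_diff_hpart[of N g] \<open>N \<ge> 1\<close> by simp
      have ev: "eval_poly g a
          = det (\<chi> i j. (if i = j then 1 else 0) + t * (hessian V a $ i $ j - (if i = j then 1 else 0)))
            - t ^ CARD('n) * det (\<chi> i j. hessian V a $ i $ j - (if i = j then 1 else 0))" for a
      proof -
        have if_ev: "eval_poly (if b then 1 else 0) a = (if b then 1 else 0)" for b
          by simp
        show ?thesis
          unfolding g_def eval_poly_diff eval_poly_mult eval_poly_det A_def B_def H_def hessian_def
            vec_lambda_beta eval_poly_add eval_poly_Const if_ev ..
      qed
      have tau0: "tau (CARD('n) - 1) (Lambda k V (darboux_rep V P)) \<noteq> 0" if "P \<in> proper_darboux_points V" for P
        by (rule sum_over_darboux_points(2)[OF k hom proper simple deg_le_0[of 0] _ _ that])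
          (use k in simp_all)
      have "(\<Sum>P\<in>proper_darboux_points V.
            eval_poly g (darboux_rep V P) / tau (CARD('n) - 1) (Lambda k V (darboux_rep V P)))
          = (- 1) ^ (CARD('n) - 1) * eval_poly g 0"
      proof (rule sum_over_darboux_points(1)[OF k hom proper simple deg])
        show "N - 1 < CARD('n) * (k - 2)"
          unfolding N_def[symmetric] using \<open>N \<ge> 1\<close> by simp
      qed (simp_all only: ev)
      also have "(\<Sum>P\<in>proper_darboux_points V.
            eval_poly g (darboux_rep V P) / tau (CARD('n) - 1) (Lambda k V (darboux_rep V P)))
          = (\<Sum>P\<in>proper_darboux_points V. (1 + t * (of_nat k - 2))
              * (\<Sum>r\<le>CARD('n) - 1. tau r (Lambda k V (darboux_rep V P))
                  / tau (CARD('n) - 1) (Lambda k V (darboux_rep V P)) * t ^ r)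
              - t ^ CARD('n) * (of_nat k - 2))"
      proof (rule sum.cong[OF refl])
        fix P assume P: "P \<in> proper_darboux_points V"
        let ?\<tau> = "tau (CARD('n) - 1) (Lambda k V (darboux_rep V P))"
        have "eval_poly g (darboux_rep V P) / ?\<tau>
            = (1 + t * (of_nat k - 2)) * ((\<Sum>r\<le>CARD('n) - 1. tau r (Lambda k V (darboux_rep V P)) * t ^ r) / ?\<tau>)
              - t ^ CARD('n) * (of_nat k - 2)"
          unfolding ev det_identity_plus_hessian[OF k hom rep[OF P]] det_hessian_minus_identity[OF k hom rep[OF P]]
          using tau0[OF P] by (simp add: diff_divide_distrib)
        then show "eval_poly g (darboux_rep V P) / ?\<tau>
            = (1 + t * (of_nat k - 2)) * (\<Sum>r\<le>CARD('n) - 1. tau r (Lambda k V (darboux_rep V P)) / ?\<tau> * t ^ r)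
              - t ^ CARD('n) * (of_nat k - 2)"
          by (simp add: sum_divide_distrib)
      qed
      also have "\<dots> = (1 + t * (of_nat k - 2)) * (\<Sum>r\<le>CARD('n) - 1. S r * t ^ r) - C * t ^ CARD('n)"
        unfolding S_def sum_distrib_right sum_subtractf
        by (subst sum.swap) (simp add: sum_distrib_left[symmetric] C_def)
      finally have "(1 + t * (of_nat k - 2)) * (\<Sum>r\<le>CARD('n) - 1. S r * t ^ r) - C * t ^ CARD('n)
          = (- 1) ^ (CARD('n) - 1) * eval_poly g 0" .
      moreover have "eval_poly g 0 = (1 - t) ^ CARD('n) - t ^ CARD('n) * (- 1) ^ CARD('n)"
      proof -
        have "det (\<chi> i j :: 'n. (if i = j then 1 else 0) + t * (hessian V 0 $ i $ j - (if i = j then 1 else 0)))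
            = (\<Prod>i\<in>(UNIV :: 'n set). 1 - t)"
          by (subst det_diagonal) (simp_all add: hess0)
        moreover have "det (\<chi> i j :: 'n. hessian V 0 $ i $ j - (if i = j then 1 else 0)) = (\<Prod>i\<in>(UNIV :: 'n set). - 1)"
          by (subst det_diagonal) (simp_all add: hess0)
        ultimately show ?thesis by (simp add: ev)
      qed
      moreover have "(t - 1) ^ CARD('n) = (- 1) ^ CARD('n) * (1 - t) ^ CARD('n)"
        unfolding power_mult_distrib[symmetric] by simp
      moreover have "(- 1) ^ CARD('n) = - ((- 1) ^ (CARD('n) - 1) :: complex)"
        using n by (cases "CARD('n)") simp_all
      moreover have "(- 1) ^ (CARD('n) - 1) * (- 1) ^ (CARD('n) - 1) = (1 :: complex)"
        by (simp flip: power_add)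
      \<comment> \<open>Here \<open>L\<close> is the left side of the identity, \<open>T\<close> is
        t^n, \<open>U\<close> is (t-1)^n, \<open>W\<close> is (1-t)^n, \<open>G\<close> is g(0), and
        \<open>s\<close>, \<open>s'\<close> are the signs with exponents n - 1 and n.\<close>
      moreover have "L = (C + 1) * T - U"
        if "L - C * T = s * G" "G = W - T * s'" "U = s' * W" "s' = - s" "s * s = 1" for L T U s s' G W :: complex
        using that by algebra
      ultimately show ?thesis by blast
    qed
    \<comment> \<open>Equality of values at all t becomes equality of coefficients.\<close>
    define Q where "Q = (\<Sum>r\<le>CARD('n) - 1. monom (S r) r)"
    have coeffQ: "coeff Q r = S r" if "r < CARD('n)" for r
      using that by (simp add: Q_def coeff_sum)
    have "poly ([:1, of_nat k - 2:] * Q) t = poly (monom (C + 1) CARD('n) - [:- 1, 1:] ^ CARD('n)) t" for t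
    proof -
      have "poly Q t = (\<Sum>r\<le>CARD('n) - 1. S r * t ^ r)"
        by (simp add: Q_def poly_sum poly_monom)
      moreover have "poly ([:1, of_nat k - 2:] * Q) t = (1 + t * (of_nat k - 2)) * poly Q t"
        by (simp del: mult_pCons_left)
      ultimately show ?thesis
        using key[of t] by (simp add: poly_monom)
    qed
    then have "[:1, of_nat k - 2:] * Q = monom (C + 1) CARD('n) - [:- 1, 1:] ^ CARD('n)"
      by (intro poly_ext)
    \<comment> \<open>For r < n the monomial with t^n does not contribute, and the binomial
      expansion of -(t-1)^n remains.\<close>
    then have c: "coeff Q r + (of_nat k - 2) * (if r = 0 then 0 else coeff Q (r - 1))
        = - (of_nat (CARD('n) choose r) * (- 1) ^ (CARD('n) - r))" if "r < CARD('n)" for r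
      using that coeff_pCons2_mult[of "of_nat k - 2" Q r] by (simp add: coeff_linear_poly_power)
    show ?thesis
    proof (rule recurrence_solution)
      show "S 0 = - ((- 1) ^ CARD('n))"
        using c[of 0] coeffQ[of 0] by simp
      show "S (Suc r) + (of_nat k - 1 - 1) * S r = - (of_nat (CARD('n) choose Suc r) * (- 1) ^ (CARD('n) - Suc r))"
        if "Suc r < CARD('n)" for r
        using c[of "Suc r"] coeffQ[of r] coeffQ[of "Suc r"] that by simp
      show "r < CARD('n)" using r n by simp
    qed
  qed
  ultimately show "(\<Sum>P\<in>proper_darboux_points V.
          tau 1 (Lambda k V (darboux_rep V P)) ^ r / tau (CARD('n) - 1) (Lambda k V (darboux_rep V P)))
        = (- 1) ^ (CARD('n) - 1) * (- of_nat CARD('n) - (of_nat k - 2)) ^ r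
    \<and> (\<Sum>P\<in>proper_darboux_points V.
          tau r (Lambda k V (darboux_rep V P)) / tau (CARD('n) - 1) (Lambda k V (darboux_rep V P)))
        = (- 1) ^ (r + CARD('n) - 1)
            * (\<Sum>i = 0..r. of_nat ((CARD('n) - i - 1) choose (r - i)) * (of_nat k - 1) ^ i)"
    unfolding S_def by (rule conjI)
qed

end
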